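(* Let $M^n=\overline M^p\times_f\widetilde M^{n-p}$ be a warped product manifold. Then $M$ satisfies $R\cdot R=0$ if and only if the following conditions hold simultaneously on $M$: (I) $\overline R\cdot\overline R=0$; (II) $T_{as}T_{bc}-T_{ac}T_{bs}+T^t_s\overline R_{abct}=0$; (III) $T_{as}\left(\widetilde R_{\eta\alpha\beta\gamma}-f\Delta\widetilde G_{\eta\alpha\beta\gamma}\right)+f\,T^2_{as}\widetilde G_{\eta\alpha\beta\gamma}=0$; (IV) $\widetilde R\cdot\widetilde R=f\Delta\,Q(\widetilde g,\widetilde R)$.
   Context: Setting. $(\overline M,\overline g)$ and $(\widetilde M,\widetilde g)$ are smooth semi-Riemannian manifolds of dimensions $p$ and $n-p$, $1\le p\le n-1$, $n\ge3$; $f$ is a positive smooth function on $\overline M$. The warped product $M=\overline M\times_f\widetilde M$ is the product manifold (assumed connected) with metric $g=\pi^*\overline g+(f\circ\pi)\,\sigma^*\widetilde g$, where $\pi,\sigma$ are the projections to the base $\overline M$ and the fiber $\widetilde M$ (the factor is $f$, not $f^2$). Quantities with a bar (resp. tilde) are formed with respect to $\overline g$ (resp. $\widetilde g$); unadorned ones with respect to $g$. Tensors and functions on $\overline M$ and $\widetilde M$ are regarded on $M$ by pullback. Curvature. $\mathcal R(X,Y)Z=\nabla_X\nabla_YZ-\nabla_Y\nabla_XZ-\nabla_{[X,Y]}Z$, $R(X,Y,Z,W)=g(\mathcal R(X,Y)Z,W)$, and $G(X_1,X_2,X_3,X_4)=g(X_1,X_4)g(X_2,X_3)-g(X_1,X_3)g(X_2,X_4)$.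 Derivation tensors. For a $(0,k)$-tensor $H$ and a symmetric $(0,2)$-tensor $A$, $$(R\cdot H)(X_1,\dots,X_k,X,Y)=-H(\mathcal R(X,Y)X_1,X_2,\dots,X_k)-\cdots-H(X_1,\dots,\mathcal R(X,Y)X_k),$$ $$Q(A,H)(X_1,\dots,X_k,X,Y)=\sum_{i=1}^k\big[A(X,X_i)H(X_1,\dots,Y,\dots,X_k)-A(Y,X_i)H(X_1,\dots,X,\dots,X_k)\big],$$ with $Y$ (resp. $X$) in the $i$-th slot. Indices. In product charts, $a,b,c,s,t$ range over base indices $\{1,\dots,p\}$ and $\alpha,\beta,\gamma,\eta$ over fiber indices $\{p+1,\dots,n\}$; every displayed component identity is required for all values of its free indices. Auxiliary quantities on $\overline M$: $f_a=\partial_af$, $f_{a,b}$ the second covariant derivative with respect to $\overline g$, $T_{ab}=\frac1{2f}\big(f_{a,b}-\frac1{2f}f_af_b\big)$, $T^t_s=\overline g^{ta}T_{as}$, $T^2_{as}=T_a^tT_{ts}$, $\Delta=\frac1{4f^2}\overline g^{ab}f_af_b$. *)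

theory Defs
  imports "HOL-Analysis.Analysis"
begin

text \<open>
  A smooth manifold is given by an atlas indexed by a set of chart labels, and tensor fields by
  their coordinate expressions in the charts of that atlas, subject to the usual transformation law.
  A tangent vector at \<open>x\<close> is represented, relative to a chart around \<open>x\<close>, by its vector of
  components. The dimension is the cardinality of the (finite) index type, so a product of
  manifolds with index types \<open>'p\<close> and \<open>'q\<close> has index type \<open>'p + 'q\<close>.
\<close>

section \<open>Calculus in a chart\<close>

definition pd :: "'n \<Rightarrow> (real^'n \<Rightarrow> 'b) \<Rightarrow> real^'n \<Rightarrow> 'b::real_normed_vector"
  where "pd i h u = frechet_derivative h (at u) (axis i 1)"

text \<open>\<open>C\<^sup>\<infinity>\<close> on an open set: all iterated partial derivatives exist and are differentiable
  (hence continuous).\<close>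

definition smooth_on :: "(real^'n) set \<Rightarrow> (real^'n \<Rightarrow> 'b::real_normed_vector) \<Rightarrow> bool"
  where "smooth_on S h \<longleftrightarrow> (\<forall>is. \<forall>u\<in>S. (foldr pd is h) differentiable (at u))"

text \<open>In the next definitions \<open>g :: real^'n \<Rightarrow> real^'n^'n\<close> is the matrix of a metric on an open
  subset of \<open>real^'n\<close>, and vector fields are given by their components there.\<close>

definition bil :: "real^'n^'n \<Rightarrow> real^'n \<Rightarrow> real^'n \<Rightarrow> real"
  where "bil G X Y = X \<bullet> (G *v Y)"

text \<open>\<open>christoffel g u k i j\<close> is \<open>\<Gamma>\<^sup>k\<^sub>i\<^sub>j\<close> of the Levi-Civita connection.\<close>

definition christoffel :: "(real^'n \<Rightarrow> real^'n^'n) \<Rightarrow> real^'n \<Rightarrow> 'n \<Rightarrow> 'n \<Rightarrow> 'n \<Rightarrow> real"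
  where "christoffel g u k i j =
    (1/2) * (\<Sum>l\<in>UNIV. matrix_inv (g u) $ k $ l *
      (pd i (\<lambda>v. g v $ j $ l) u + pd j (\<lambda>v. g v $ i $ l) u - pd l (\<lambda>v. g v $ i $ j) u))"

definition cov_deriv ::
    "(real^'n \<Rightarrow> real^'n^'n) \<Rightarrow> (real^'n \<Rightarrow> real^'n) \<Rightarrow> (real^'n \<Rightarrow> real^'n) \<Rightarrow> real^'n \<Rightarrow> real^'n"
  where "cov_deriv g X Y u = frechet_derivative Y (at u) (X u) +
    (\<chi> k. \<Sum>i\<in>UNIV. \<Sum>j\<in>UNIV. christoffel g u k i j * X u $ i * Y u $ j)"

definition lie_bracket :: "(real^'n \<Rightarrow> real^'n) \<Rightarrow> (real^'n \<Rightarrow> real^'n) \<Rightarrow> real^'n \<Rightarrow> real^'n"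
  where "lie_bracket X Y u = frechet_derivative Y (at u) (X u) - frechet_derivative X (at u) (Y u)"

definition curv_field :: "(real^'n \<Rightarrow> real^'n^'n) \<Rightarrow> (real^'n \<Rightarrow> real^'n) \<Rightarrow> (real^'n \<Rightarrow> real^'n) \<Rightarrow>
    (real^'n \<Rightarrow> real^'n) \<Rightarrow> real^'n \<Rightarrow> real^'n"
  where "curv_field g X Y Z u =
    cov_deriv g X (cov_deriv g Y Z) u - cov_deriv g Y (cov_deriv g X Z) u
      - cov_deriv g (lie_bracket X Y) Z u"

text \<open>The curvature is tensorial, so its value on tangent vectors at \<open>u\<close> is obtained by extending
  these to vector fields; here with constant components, i.e. to constant-coefficient combinations
  of the coordinate fields.\<close>

definition curv_at :: "(real^'n \<Rightarrow> real^'n^'n) \<Rightarrow> real^'n \<Rightarrow> real^'n \<Rightarrow> real^'n \<Rightarrow> real^'n \<Rightarrow> real^'n"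
  where "curv_at g u X Y Z = curv_field g (\<lambda>_. X) (\<lambda>_. Y) (\<lambda>_. Z) u"

section \<open>Semi-Riemannian manifolds\<close>

text \<open>\<open>gmat M i u\<close> is the matrix of the metric in the chart \<open>i\<close>, at the point with coordinates
  \<open>u\<close>.\<close>

record ('a, 'i, 'n::finite) semi_riemannian =
  mtop :: "'a topology"
  charts :: "'i set"
  chart_dom :: "'i \<Rightarrow> 'a set"
  coord :: "'i \<Rightarrow> 'a \<Rightarrow> real^'n"
  gmat :: "'i \<Rightarrow> real^'n \<Rightarrow> real^'n^'n"

abbreviation chart_inv :: "('a, 'i, 'n::finite) semi_riemannian \<Rightarrow> 'i \<Rightarrow> real^'n \<Rightarrow> 'a"
  where "chart_inv M i \<equiv> inv_into (chart_dom M i) (coord M i)"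

definition local_rep ::
    "('a, 'i, 'n::finite) semi_riemannian \<Rightarrow> 'i \<Rightarrow> ('a \<Rightarrow> real) \<Rightarrow> real^'n \<Rightarrow> real"
  where "local_rep M i h u = h (chart_inv M i u)"

definition transition ::
    "('a, 'i, 'n::finite) semi_riemannian \<Rightarrow> 'i \<Rightarrow> 'i \<Rightarrow> real^'n \<Rightarrow> real^'n"
  where "transition M i j u = coord M j (chart_inv M i u)"

definition smooth_manifold :: "('a, 'i, 'n::finite) semi_riemannian \<Rightarrow> bool"
  where "smooth_manifold M \<longleftrightarrow>
    Hausdorff_space (mtop M) \<and> second_countable (mtop M) \<and>
    (\<Union>i\<in>charts M. chart_dom M i) = topspace (mtop M) \<and>
    (\<forall>i\<in>charts M. openin (mtop M) (chart_dom M i) \<and>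
       open (coord M i ` chart_dom M i) \<and>
       homeomorphic_map (subtopology (mtop M) (chart_dom M i))
         (top_of_set (coord M i ` chart_dom M i)) (coord M i)) \<and>
    (\<forall>i\<in>charts M. \<forall>j\<in>charts M.
       smooth_on (coord M i ` (chart_dom M i \<inter> chart_dom M j)) (transition M i j))"

text \<open>The index of a semi-Riemannian metric is automatically locally constant, hence constant on a
  connected manifold.\<close>

definition semi_riemannian_manifold :: "('a, 'i, 'n::finite) semi_riemannian \<Rightarrow> bool"
  where "semi_riemannian_manifold M \<longleftrightarrow> smooth_manifold M \<and>
    (\<forall>i\<in>charts M.
       (\<forall>k l. smooth_on (coord M i ` chart_dom M i) (\<lambda>u. gmat M i u $ k $ l)) \<and>
       (\<forall>u\<in>coord M i ` chart_dom M i. transpose (gmat M i u) = gmat M i u \<and> invertible (gmat M i u))) \<and>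
    (\<forall>i\<in>charts M. \<forall>j\<in>charts M. \<forall>u\<in>coord M i ` (chart_dom M i \<inter> chart_dom M j).
       let J = matrix (frechet_derivative (transition M i j) (at u))
       in gmat M i u = transpose J ** gmat M j (transition M i j u) ** J)"

definition smooth_fun :: "('a, 'i, 'n::finite) semi_riemannian \<Rightarrow> ('a \<Rightarrow> real) \<Rightarrow> bool"
  where "smooth_fun M h \<longleftrightarrow>
    (\<forall>i\<in>charts M. smooth_on (coord M i ` chart_dom M i) (local_rep M i h))"

text \<open>From here on, \<open>i\<close> is a chart label and \<open>x\<close> a point in the domain of that chart; tangent
  vectors at \<open>x\<close> are given by their components in the chart \<open>i\<close>.\<close>

definition metric_tensor ::
    "('a, 'i, 'n::finite) semi_riemannian \<Rightarrow> 'i \<Rightarrow> 'a \<Rightarrow> real^'n \<Rightarrow> real^'n \<Rightarrow> real"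
  where "metric_tensor M i x X Y = bil (gmat M i (coord M i x)) X Y"

definition curv_op ::
    "('a, 'i, 'n::finite) semi_riemannian \<Rightarrow> 'i \<Rightarrow> 'a \<Rightarrow> real^'n \<Rightarrow> real^'n \<Rightarrow> real^'n \<Rightarrow> real^'n"
  where "curv_op M i x X Y Z = curv_at (gmat M i) (coord M i x) X Y Z"

definition riem :: "('a, 'i, 'n::finite) semi_riemannian \<Rightarrow> 'i \<Rightarrow> 'a \<Rightarrow>
    real^'n \<Rightarrow> real^'n \<Rightarrow> real^'n \<Rightarrow> real^'n \<Rightarrow> real"
  where "riem M i x X Y Z W = metric_tensor M i x (curv_op M i x X Y Z) W"

definition G_tensor :: "('a, 'i, 'n::finite) semi_riemannian \<Rightarrow> 'i \<Rightarrow> 'a \<Rightarrow>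
    real^'n \<Rightarrow> real^'n \<Rightarrow> real^'n \<Rightarrow> real^'n \<Rightarrow> real"
  where "G_tensor M i x X1 X2 X3 X4 =
    metric_tensor M i x X1 X4 * metric_tensor M i x X2 X3
      - metric_tensor M i x X1 X3 * metric_tensor M i x X2 X4"

section \<open>Derivation tensors\<close>

text \<open>A \<open>(0,k)\<close>-tensor at a point is a function of lists of tangent vectors of length \<open>k\<close>.\<close>

definition curv_dot :: "('v \<Rightarrow> 'v \<Rightarrow> 'v \<Rightarrow> 'v) \<Rightarrow> ('v list \<Rightarrow> real) \<Rightarrow> 'v list \<Rightarrow> 'v \<Rightarrow> 'v \<Rightarrow> real"
  where "curv_dot Rop H Xs X Y = - (\<Sum>m<length Xs. H (Xs[m := Rop X Y (Xs ! m)]))"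

definition tachibana_Q :: "('v \<Rightarrow> 'v \<Rightarrow> real) \<Rightarrow> ('v list \<Rightarrow> real) \<Rightarrow> 'v list \<Rightarrow> 'v \<Rightarrow> 'v \<Rightarrow> real"
  where "tachibana_Q A H Xs X Y =
    (\<Sum>m<length Xs. A X (Xs ! m) * H (Xs[m := Y]) - A Y (Xs ! m) * H (Xs[m := X]))"

definition riem4 :: "('a, 'i, 'n::finite) semi_riemannian \<Rightarrow> 'i \<Rightarrow> 'a \<Rightarrow> (real^'n) list \<Rightarrow> real"
  where "riem4 M i x Xs = riem M i x (Xs ! 0) (Xs ! 1) (Xs ! 2) (Xs ! 3)"

definition R_dot_R ::
    "('a, 'i, 'n::finite) semi_riemannian \<Rightarrow> 'i \<Rightarrow> 'a \<Rightarrow> (real^'n) list \<Rightarrow> real^'n \<Rightarrow> real^'n \<Rightarrow> real"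
  where "R_dot_R M i x = curv_dot (curv_op M i x) (riem4 M i x)"

definition Q_g_R ::
    "('a, 'i, 'n::finite) semi_riemannian \<Rightarrow> 'i \<Rightarrow> 'a \<Rightarrow> (real^'n) list \<Rightarrow> real^'n \<Rightarrow> real^'n \<Rightarrow> real"
  where "Q_g_R M i x = tachibana_Q (metric_tensor M i x) (riem4 M i x)"

definition semisymmetric :: "('a, 'i, 'n::finite) semi_riemannian \<Rightarrow> bool"
  where "semisymmetric M \<longleftrightarrow> (\<forall>i\<in>charts M. \<forall>x\<in>chart_dom M i.
    \<forall>Xs X Y. length Xs = 4 \<longrightarrow> R_dot_R M i x Xs X Y = 0)"

section \<open>Warped products\<close>

text \<open>\<open>base_part\<close> and \<open>fiber_part\<close> are the projections onto the two factors expressed in product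
  coordinates; being linear, they are also the differentials of these projections.\<close>

definition join :: "real^'p::finite \<Rightarrow> real^'q::finite \<Rightarrow> real^('p + 'q)"
  where "join u v = (\<chi> k. case k of Inl a \<Rightarrow> u $ a | Inr \<alpha> \<Rightarrow> v $ \<alpha>)"

definition base_part :: "real^('p::finite + 'q::finite) \<Rightarrow> real^'p"
  where "base_part w = (\<chi> a. w $ Inl a)"

definition fiber_part :: "real^('p::finite + 'q::finite) \<Rightarrow> real^'q"
  where "fiber_part w = (\<chi> \<alpha>. w $ Inr \<alpha>)"

definition pullback_form :: "(real^'n::finite \<Rightarrow> real^'m::finite) \<Rightarrow> real^'m^'m \<Rightarrow> real^'n^'n"
  where "pullback_form L G = (\<chi> k l. bil G (L (axis k 1)) (L (axis l 1)))"

text \<open>The charts of the product are the products of the charts of the factors. The warping factor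
  is \<open>f\<close>, not \<open>f\<^sup>2\<close>.\<close>

definition warped_product :: "('a, 'i, 'p::finite) semi_riemannian \<Rightarrow> ('a \<Rightarrow> real) \<Rightarrow>
    ('b, 'j, 'q::finite) semi_riemannian \<Rightarrow> ('a \<times> 'b, 'i \<times> 'j, 'p + 'q) semi_riemannian"
  where "warped_product B f F = \<lparr>
    mtop = prod_topology (mtop B) (mtop F),
    charts = charts B \<times> charts F,
    chart_dom = (\<lambda>(i, j). chart_dom B i \<times> chart_dom F j),
    coord = (\<lambda>(i, j) (x, y). join (coord B i x) (coord F j y)),
    gmat = (\<lambda>(i, j) w. pullback_form base_part (gmat B i (base_part w)) +
      local_rep B i f (base_part w) *\<^sub>R pullback_form fiber_part (gmat F j (fiber_part w)))\<rparr>"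

section \<open>Auxiliary quantities on the base\<close>

definition d1 :: "('a, 'i, 'n::finite) semi_riemannian \<Rightarrow> ('a \<Rightarrow> real) \<Rightarrow> 'i \<Rightarrow> 'a \<Rightarrow> 'n \<Rightarrow> real"
  where "d1 B f i x a = pd a (local_rep B i f) (coord B i x)"

text \<open>\<open>f\<^sub>a\<^sub>,\<^sub>b = \<partial>\<^sub>b \<partial>\<^sub>a f - \<Gamma>\<^sup>c\<^sub>a\<^sub>b \<partial>\<^sub>c f\<close>\<close>

definition cov_hess ::
    "('a, 'i, 'n::finite) semi_riemannian \<Rightarrow> ('a \<Rightarrow> real) \<Rightarrow> 'i \<Rightarrow> 'a \<Rightarrow> 'n \<Rightarrow> 'n \<Rightarrow> real"
  where "cov_hess B f i x a b = pd b (pd a (local_rep B i f)) (coord B i x)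
    - (\<Sum>c\<in>UNIV. christoffel (gmat B i) (coord B i x) c a b * d1 B f i x c)"

definition ginv :: "('a, 'i, 'n::finite) semi_riemannian \<Rightarrow> 'i \<Rightarrow> 'a \<Rightarrow> 'n \<Rightarrow> 'n \<Rightarrow> real"
  where "ginv B i x a b = matrix_inv (gmat B i (coord B i x)) $ a $ b"

definition warp_T ::
    "('a, 'i, 'n::finite) semi_riemannian \<Rightarrow> ('a \<Rightarrow> real) \<Rightarrow> 'i \<Rightarrow> 'a \<Rightarrow> 'n \<Rightarrow> 'n \<Rightarrow> real"
  where "warp_T B f i x a b =
    1 / (2 * f x) * (cov_hess B f i x a b - 1 / (2 * f x) * d1 B f i x a * d1 B f i x b)"

text \<open>\<open>T\<^sup>t\<^sub>s\<close>, upper index first\<close>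

definition warp_T_up ::
    "('a, 'i, 'n::finite) semi_riemannian \<Rightarrow> ('a \<Rightarrow> real) \<Rightarrow> 'i \<Rightarrow> 'a \<Rightarrow> 'n \<Rightarrow> 'n \<Rightarrow> real"
  where "warp_T_up B f i x t s = (\<Sum>a\<in>UNIV. ginv B i x t a * warp_T B f i x a s)"

text \<open>\<open>T\<^sup>2\<^sub>a\<^sub>s = T\<^sup>t\<^sub>a T\<^sub>t\<^sub>s\<close>\<close>

definition warp_T2 ::
    "('a, 'i, 'n::finite) semi_riemannian \<Rightarrow> ('a \<Rightarrow> real) \<Rightarrow> 'i \<Rightarrow> 'a \<Rightarrow> 'n \<Rightarrow> 'n \<Rightarrow> real"
  where "warp_T2 B f i x a s = (\<Sum>t\<in>UNIV. warp_T_up B f i x t a * warp_T B f i x t s)"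

definition warp_Delta :: "('a, 'i, 'n::finite) semi_riemannian \<Rightarrow> ('a \<Rightarrow> real) \<Rightarrow> 'i \<Rightarrow> 'a \<Rightarrow> real"
  where "warp_Delta B f i x = 1 / (4 * (f x)\<^sup>2) *
    (\<Sum>a\<in>UNIV. \<Sum>b\<in>UNIV. ginv B i x a b * d1 B f i x a * d1 B f i x b)"

abbreviation (input) \<e> :: "'n \<Rightarrow> real^'n"
  where "\<e> k \<equiv> axis k 1"

definition riem_comp :: "('a, 'i, 'n::finite) semi_riemannian \<Rightarrow> 'i \<Rightarrow> 'a \<Rightarrow>
    'n \<Rightarrow> 'n \<Rightarrow> 'n \<Rightarrow> 'n \<Rightarrow> real"
  where "riem_comp M i x a b c d = riem M i x (\<e> a) (\<e> b) (\<e> c) (\<e> d)"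

definition G_comp :: "('a, 'i, 'n::finite) semi_riemannian \<Rightarrow> 'i \<Rightarrow> 'a \<Rightarrow>
    'n \<Rightarrow> 'n \<Rightarrow> 'n \<Rightarrow> 'n \<Rightarrow> real"
  where "G_comp M i x a b c d = G_tensor M i x (\<e> a) (\<e> b) (\<e> c) (\<e> d)"

end

theory Submission
  imports Defs
begin

text \<open>Everything happens at one point of one product chart, where the question is linear algebra in
the curvature tensor of the warped product. Write a tangent vector as \<open>X = (x, u)\<close> with base part
\<open>x\<close> and fiber part \<open>u\<close>, and let \<open>p = R\<^sub>F - f \<Delta> G\<^sub>F\<close>, an algebraic curvature tensor on the fiber.
The classical computation gives
\<open>R(X\<^sub>1,X\<^sub>2,X\<^sub>3,X\<^sub>4) = R\<^sub>B(x\<^sub>1,x\<^sub>2,x\<^sub>3,x\<^sub>4) + f p(u\<^sub>1,u\<^sub>2,u\<^sub>3,u\<^sub>4)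
  - f (T(x\<^sub>2,x\<^sub>3) h(u\<^sub>1,u\<^sub>4) + T(x\<^sub>1,x\<^sub>4) h(u\<^sub>2,u\<^sub>3) - T(x\<^sub>1,x\<^sub>3) h(u\<^sub>2,u\<^sub>4) - T(x\<^sub>2,x\<^sub>4) h(u\<^sub>1,u\<^sub>3))\<close>,
where \<open>h\<close> is the fiber metric (theorem \<open>lowered_curv_gW\<close>).

Call the four conditions of the theorem, in their order, (I) to (IV).
Now let the endomorphism \<open>\<R>(X,Y)\<close> act on \<open>R\<close> as a derivation. If \<open>X, Y\<close> are both tangent to the
base, the action on four base vectors is \<open>R\<^sub>B \<cdot> R\<^sub>B\<close>, and on two base and two fiber vectors it is the
action of \<open>R\<^sub>B\<close> on \<open>T\<close>. If both are tangent to the fiber, only \<open>p \<cdot> p\<close> survives, because \<open>p\<close> acts skew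
on \<open>h\<close>. If one is tangent to each factor, base and fiber directions are exchanged, so the result can
be nonzero only on three vectors of one factor and one of the other: three base vectors give (II)
times a multiple of \<open>h(u,v)\<close>, three fiber vectors give (III). Thus \<open>R \<cdot> R = 0\<close> amounts to (I), (II),
(III), \<open>p \<cdot> p = 0\<close> and \<open>R\<^sub>B \<cdot> T = 0\<close>. The last one is a consequence of (II): condition (II) expresses
\<open>T(\<R>\<^sub>B(x,y)z, w)\<close> by a polynomial in \<open>T\<close> that is skew in \<open>z, w\<close>, and \<open>R\<^sub>B \<cdot> T\<close> is its symmetrisation.
And \<open>p \<cdot> p = 0\<close> is (IV), since an endomorphism \<open>\<R>(X,Y)\<close> that is skew for \<open>h\<close> kills \<open>G\<^sub>F\<close>, while the
constant curvature part of \<open>p\<close> acts on \<open>R\<^sub>F\<close> as the Tachibana tensor \<open>Q(h, R\<^sub>F)\<close>. This algebra is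
theorem \<open>semisymmetric_iff\<close> together with \<open>derivation4_shifted\<close>.

The curvature is computed from the fully covariant formula
\<open>R\<^sub>i\<^sub>j\<^sub>k\<^sub>l = (\<partial>\<^sub>i\<partial>\<^sub>k g\<^sub>j\<^sub>l + \<partial>\<^sub>j\<partial>\<^sub>l g\<^sub>i\<^sub>k - \<partial>\<^sub>i\<partial>\<^sub>l g\<^sub>j\<^sub>k - \<partial>\<^sub>j\<partial>\<^sub>k g\<^sub>i\<^sub>l) / 2 + g\<^sup>m\<^sup>n ([jl,m][ik,n] - [il,m][jk,n])\<close>
(theorem \<open>bil_curv_at_axes\<close>), in which the inverse metric is not differentiated. For a
block diagonal metric \<open>g\<^sub>B + f g\<^sub>F\<close> each block can be read off. The symmetries of \<open>R\<close> and \<open>T\<close> rest on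
the symmetry of second partial derivatives (lemma \<open>pd_commute\<close>).\<close>

section \<open>Partial derivatives\<close>

lemma pd_cong_open:
  assumes "open S" "u \<in> S" "\<And>v. v \<in> S \<Longrightarrow> h v = k v"
  shows "pd i h u = pd i k u"
proof -
  have "(h has_derivative D) (at u) \<longleftrightarrow> (k has_derivative D) (at u)" for D
    using assms by (metis has_derivative_transform_within_open)
  then show ?thesis
    unfolding pd_def frechet_derivative_def by simp
qed

lemma pd_eqI: "(h has_derivative D) (at u) \<Longrightarrow> pd i h u = D (axis i 1)"
  unfolding pd_def by (metis frechet_derivative_at)

lemma frechet_derivative_eq_sum_pd:
  fixes h :: "real^'n::finite \<Rightarrow> 'b::real_normed_vector"
  assumes "h differentiable (at u)"
  shows "frechet_derivative h (at u) X = (\<Sum>i\<in>UNIV. X $ i *\<^sub>R pd i h u)"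
proof -
  interpret linear "frechet_derivative h (at u)"
    using assms by (rule linear_frechet_derivative)
  have "X = (\<Sum>i\<in>UNIV. X $ i *\<^sub>R axis i 1)"
    using basis_expansion[of X] by (simp add: scalar_mult_eq_scaleR)
  then have "frechet_derivative h (at u) X = frechet_derivative h (at u) (\<Sum>i\<in>UNIV. X $ i *\<^sub>R axis i 1)"
    by simp
  then show ?thesis
    by (simp add: sum scale pd_def)
qed

lemma pd_add:
  assumes "h differentiable (at u)" "k differentiable (at u)"
  shows "pd i (\<lambda>v. h v + k v) u = pd i h u + pd i k u"
  using assms unfolding pd_def
  by (subst frechet_derivative_at[OF has_derivative_add, symmetric])
     (auto simp: frechet_derivative_works)

lemma pd_diff:
  assumes "h differentiable (at u)" "k differentiable (at u)"
  shows "pd i (\<lambda>v. h v - k v) u = pd i h u - pd i k u"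
  using assms unfolding pd_def
  by (subst frechet_derivative_at[OF has_derivative_diff, symmetric])
     (auto simp: frechet_derivative_works)

lemma pd_mult:
  fixes h k :: "real^'n::finite \<Rightarrow> real"
  assumes "h differentiable (at u)" "k differentiable (at u)"
  shows "pd i (\<lambda>v. h v * k v) u = pd i h u * k u + h u * pd i k u"
  using assms unfolding pd_def
  by (subst frechet_derivative_at[OF has_derivative_mult, symmetric])
     (auto simp: frechet_derivative_works)

lemma pd_sum:
  assumes "\<And>m. m \<in> A \<Longrightarrow> h m differentiable (at u)"
  shows "pd i (\<lambda>v. \<Sum>m\<in>A. h m v) u = (\<Sum>m\<in>A. pd i (h m) u)"
  using assms unfolding pd_def
  by (subst frechet_derivative_at[OF has_derivative_sum, symmetric])
     (auto simp: frechet_derivative_works)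

lemma pd_const [simp]: "pd i (\<lambda>_. c) u = 0"
  by (simp add: pd_def)

lemma pd_cmult:
  fixes h :: "real^'n::finite \<Rightarrow> real"
  assumes "h differentiable (at u)"
  shows "pd i (\<lambda>v. c * h v) u = c * pd i h u"
  using pd_mult[of "\<lambda>_. c" u h] assms by simp

text \<open>Young's argument: the mean value theorem in direction \<open>i\<close>, followed by the differentiability of
\<open>\<partial>\<^sub>ih\<close> at the single point \<open>u\<close>. The difference quotient is symmetric in \<open>i\<close> and \<open>j\<close>, so the same limit
computed in the other order gives the symmetry of second derivatives.\<close>

lemma second_difference_quotient:
  fixes h :: "real^'n::finite \<Rightarrow> real"
  assumes S: "open S" "u \<in> S"
    and h: "\<And>v. v \<in> S \<Longrightarrow> h differentiable (at v)"
    and d: "pd i h differentiable (at u)"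
  shows "((\<lambda>t. (h (u + t *\<^sub>R axis i 1 + t *\<^sub>R axis j 1) - h (u + t *\<^sub>R axis i 1)
      - h (u + t *\<^sub>R axis j 1) + h u) / t\<^sup>2) \<longlongrightarrow> pd j (pd i h) u) (at_right 0)"
proof (rule tendstoI)
  fix e :: real assume e: "e > 0"
  define L where "L = frechet_derivative (pd i h) (at u)"
  define a where "a = (axis i 1 :: real^'n)"
  define b where "b = (axis j 1 :: real^'n)"
  have [simp]: "norm a = 1" "norm b = 1" by (simp_all add: a_def b_def)
  have dL: "(pd i h has_derivative L) (at u)"
    using d by (simp add: L_def frechet_derivative_works)
  then interpret L: bounded_linear L by (rule has_derivative_bounded_linear)
  \<comment> \<open>The two error terms below add up to less than four times \<open>(e / 4) t\<close>.\<close>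
  have "e / 4 > 0" using e by simp
  then obtain r1 where r1: "r1 > 0"
    and r1': "\<And>y. norm (y - u) < r1 \<Longrightarrow> norm (pd i h y - pd i h u - L (y - u)) \<le> e / 4 * norm (y - u)"
    using dL unfolding has_derivative_at_alt by blast
  obtain r2 where r2: "r2 > 0" "ball u r2 \<subseteq> S"
    using S openE by blast
  define r where "r = min r1 r2 / 2"
  have r: "r > 0" using r1 r2 by (simp add: r_def)
  have key: "\<bar>(h (u + t *\<^sub>R a + t *\<^sub>R b) - h (u + t *\<^sub>R a) - h (u + t *\<^sub>R b) + h u) / t\<^sup>2 - L b\<bar> < e"
    if t: "0 < t" "t < r" for t
  proof -
    have small: "norm (s *\<^sub>R a + c *\<^sub>R b) \<le> s + c" if "0 \<le> s" "0 \<le> c" for s c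
      using that by (intro order_trans[OF norm_triangle_ineq]) simp
    have inS: "u + s *\<^sub>R a + c *\<^sub>R b \<in> S" if "0 \<le> s" "s \<le> t" "0 \<le> c" "c \<le> t" for s c
    proof -
      have "norm (s *\<^sub>R a + c *\<^sub>R b) < r2"
        using small[of s c] that t by (simp add: r_def)
      then show ?thesis using r2(2)
        by (auto simp: subset_iff dist_norm add.assoc norm_minus_commute)
    qed
    \<comment> \<open>The mean value theorem in direction \<open>i\<close>, for the difference of \<open>h\<close> in direction \<open>j\<close>.\<close>
    have der: "((\<lambda>s. h (u + s *\<^sub>R a + c *\<^sub>R b)) has_real_derivative pd i h (u + s *\<^sub>R a + c *\<^sub>R b)) (at s)"
      if "0 \<le> s" "s \<le> t" "0 \<le> c" "c \<le> t" for s c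
    proof -
      let ?v = "u + s *\<^sub>R a + c *\<^sub>R b"
      have hv: "(h has_derivative frechet_derivative h (at ?v)) (at ?v)"
        using h[OF inS[OF that]] by (simp add: frechet_derivative_works)
      have "((\<lambda>s. u + s *\<^sub>R a + c *\<^sub>R b) has_derivative (\<lambda>s. s *\<^sub>R a)) (at s)"
        by (auto intro!: derivative_eq_intros)
      from has_derivative_compose[OF this hv]
      have "((\<lambda>s. h (u + s *\<^sub>R a + c *\<^sub>R b)) has_derivative (\<lambda>s. frechet_derivative h (at ?v) (s *\<^sub>R a))) (at s)" .
      moreover have "frechet_derivative h (at ?v) (s *\<^sub>R a) = pd i h ?v * s" for s
        using linear_cmul[OF linear_frechet_derivative[OF h[OF inS[OF that]]]]
        by (simp add: pd_def a_def)
      ultimately show ?thesis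
        unfolding has_field_derivative_def by simp
    qed
    have "\<exists>z>0. z < t \<and> (h (u + t *\<^sub>R a + t *\<^sub>R b) - h (u + t *\<^sub>R a + 0 *\<^sub>R b))
        - (h (u + 0 *\<^sub>R a + t *\<^sub>R b) - h (u + 0 *\<^sub>R a + 0 *\<^sub>R b)) =
        (t - 0) * (pd i h (u + z *\<^sub>R a + t *\<^sub>R b) - pd i h (u + z *\<^sub>R a + 0 *\<^sub>R b))"
      using t by (intro MVT2 DERIV_diff der) auto
    then obtain z where z: "0 < z" "z < t" and
      eq: "h (u + t *\<^sub>R a + t *\<^sub>R b) - h (u + t *\<^sub>R a) - h (u + t *\<^sub>R b) + h u =
        t * (pd i h (u + z *\<^sub>R a + t *\<^sub>R b) - pd i h (u + z *\<^sub>R a))"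
      by (auto simp: algebra_simps)
    have est: "\<bar>pd i h (u + (z *\<^sub>R a + c *\<^sub>R b)) - pd i h u - (z * L a + c * L b)\<bar> \<le> e / 4 * (z + c)"
      if "0 \<le> c" "c \<le> t" for c
    proof -
      have "norm (z *\<^sub>R a + c *\<^sub>R b) \<le> z + c" "norm (z *\<^sub>R a + c *\<^sub>R b) < r1"
        using small[of z c] that t z by (auto simp: r_def)
      with r1'[of "u + (z *\<^sub>R a + c *\<^sub>R b)"] e show ?thesis
        by (simp add: L.add L.scaleR) (smt (verit) mult_left_mono divide_nonneg_nonneg e)
    qed
    have est0: "\<bar>pd i h (u + z *\<^sub>R a) - pd i h u - z * L a\<bar> \<le> e / 4 * z"
      using est[of 0] t by simp
    have "\<bar>A - C - Q\<bar> \<le> x + y" if "\<bar>A - U - (P + Q)\<bar> \<le> x" "\<bar>C - U - P\<bar> \<le> y"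
      for A C U P Q x y :: real
      using that by linarith
    from this[OF est[of t] est0]
    have "\<bar>(pd i h (u + z *\<^sub>R a + t *\<^sub>R b) - pd i h (u + z *\<^sub>R a)) - t * L b\<bar> \<le> e / 4 * (z + t) + e / 4 * z"
      using t by (simp add: add.assoc)
    also have "\<dots> = e / 4 * (z + t + z)" by (simp only: distrib_left)
    also have "\<dots> < e / 4 * (t + t + t + t)"
      using z t e by (intro mult_strict_left_mono) auto
    finally have *: "\<bar>(pd i h (u + z *\<^sub>R a + t *\<^sub>R b) - pd i h (u + z *\<^sub>R a)) - t * L b\<bar> < e * t"
      by simp
    have quot: "(h (u + t *\<^sub>R a + t *\<^sub>R b) - h (u + t *\<^sub>R a) - h (u + t *\<^sub>R b) + h u) / t\<^sup>2 - L b =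
      ((pd i h (u + z *\<^sub>R a + t *\<^sub>R b) - pd i h (u + z *\<^sub>R a)) - t * L b) / t"
      using t unfolding eq by (simp add: field_simps power2_eq_square)
    show ?thesis
      unfolding quot abs_divide using * t by (simp add: pos_divide_less_eq)
  qed
  have "pd j (pd i h) u = L b"
    by (simp add: pd_def[of j] L_def b_def)
  then show "\<forall>\<^sub>F t in at_right 0. dist ((h (u + t *\<^sub>R axis i 1 + t *\<^sub>R axis j 1) - h (u + t *\<^sub>R axis i 1)
      - h (u + t *\<^sub>R axis j 1) + h u) / t\<^sup>2) (pd j (pd i h) u) < e"
    using key r unfolding eventually_at_right_field dist_real_def a_def b_def by auto
qed

lemma pd_commute:
  fixes h :: "real^'n::finite \<Rightarrow> real"
  assumes "open S" "u \<in> S"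
    and "\<And>v. v \<in> S \<Longrightarrow> h differentiable (at v)"
    and "pd i h differentiable (at u)" "pd j h differentiable (at u)"
  shows "pd i (pd j h) u = pd j (pd i h) u"
proof (rule tendsto_unique)
  show "((\<lambda>t. (h (u + t *\<^sub>R axis i 1 + t *\<^sub>R axis j 1) - h (u + t *\<^sub>R axis i 1)
      - h (u + t *\<^sub>R axis j 1) + h u) / t\<^sup>2) \<longlongrightarrow> pd j (pd i h) u) (at_right 0)"
    using assms by (intro second_difference_quotient)
  have "(\<lambda>t. (h (u + t *\<^sub>R axis i 1 + t *\<^sub>R axis j 1) - h (u + t *\<^sub>R axis i 1)
      - h (u + t *\<^sub>R axis j 1) + h u) / t\<^sup>2) = (\<lambda>t. (h (u + t *\<^sub>R axis j 1 + t *\<^sub>R axis i 1)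
      - h (u + t *\<^sub>R axis j 1) - h (u + t *\<^sub>R axis i 1) + h u) / t\<^sup>2)"
    by (simp add: algebra_simps)
  then show "((\<lambda>t. (h (u + t *\<^sub>R axis i 1 + t *\<^sub>R axis j 1) - h (u + t *\<^sub>R axis i 1)
      - h (u + t *\<^sub>R axis j 1) + h u) / t\<^sup>2) \<longlongrightarrow> pd i (pd j h) u) (at_right 0)"
    using second_difference_quotient[OF assms(1-3,5), of i] by simp
qed simp

text \<open>The regularity that the curvature of a metric requires. For a product of a function on the base
with a function on the fiber, only first and second derivatives have to be computed to verify it.\<close>

definition twice_differentiable_on :: "(real^'n::finite) set \<Rightarrow> (real^'n \<Rightarrow> real) \<Rightarrow> bool"
  where "twice_differentiable_on S h \<longleftrightarrow>
    (\<forall>u\<in>S. h differentiable (at u) \<and> (\<forall>i. pd i h differentiable (at u)))"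

lemma smooth_on_imp_twice_differentiable_on:
  fixes h :: "real^'n::finite \<Rightarrow> real"
  assumes "smooth_on S h"
  shows "twice_differentiable_on S h"
  using assms[unfolded smooth_on_def, THEN spec, of "[]"]
    assms[unfolded smooth_on_def, THEN spec, of "[_]"]
  by (simp add: twice_differentiable_on_def)

lemma twice_differentiable_on_commute:
  assumes "open S" "u \<in> S" "twice_differentiable_on S h"
  shows "pd i (pd j h) u = pd j (pd i h) u"
  using assms by (intro pd_commute) (auto simp: twice_differentiable_on_def)

lemma pd_const_fun: "pd i (\<lambda>_. c) = (\<lambda>_. 0)"
  by (simp add: fun_eq_iff)

lemma twice_differentiable_on_const [simp]: "twice_differentiable_on S (\<lambda>_. c)"
  by (simp add: twice_differentiable_on_def pd_const_fun)

lemma differentiable_transform_open: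
  assumes "h differentiable (at u)" "open S" "u \<in> S" "\<And>v. v \<in> S \<Longrightarrow> h v = k v"
  shows "k differentiable (at u)"
  using assms unfolding differentiable_def by (meson has_derivative_transform_within_open)

lemma frechet_derivative_nth:
  assumes "Y differentiable (at u)"
  shows "frechet_derivative Y (at u) X $ k = frechet_derivative (\<lambda>v. Y v $ k) (at u) X"
proof -
  have "(Y has_derivative frechet_derivative Y (at u)) (at u)"
    using assms by (simp add: frechet_derivative_works)
  then have "((\<lambda>v. Y v $ k) has_derivative (\<lambda>h. frechet_derivative Y (at u) h $ k)) (at u)"
    by (rule bounded_linear.has_derivative[OF bounded_linear_vec_nth])
  then show ?thesis by (simp add: frechet_derivative_at[symmetric])
qed

section \<open>Multilinear forms and inverse matrices\<close>

lemma linear_eq_0_on_axes: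
  fixes h :: "real^'n::finite \<Rightarrow> real"
  assumes "linear h" "\<And>k. h (axis k 1) = 0"
  shows "h X = 0"
proof -
  interpret linear h by fact
  have "h X = h (\<Sum>i\<in>UNIV. X $ i *\<^sub>R axis i 1)"
    using basis_expansion[of X] by (simp add: scalar_mult_eq_scaleR)
  also have "\<dots> = 0" by (simp add: sum scale assms(2))
  finally show ?thesis .
qed

text \<open>Sums against a Kronecker delta, in the forms in which \<open>axis_def\<close> and \<open>mat_def\<close> produce them.\<close>

lemma sum_times_delta:
  fixes c :: "'n::finite \<Rightarrow> real"
  shows "(\<Sum>i\<in>UNIV. c i * (if i = j then 1 else 0)) = c j"
    "(\<Sum>i\<in>UNIV. c i * (if j = i then 1 else 0)) = c j"
    "(\<Sum>i\<in>UNIV. (if i = j then 1 else 0) * c i) = c j"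
    "(\<Sum>i\<in>UNIV. (if j = i then 1 else 0) * c i) = c j"
  by (simp_all add: if_distrib[where f = "\<lambda>x. x * _"] if_distrib[where f = "\<lambda>x. _ * x"] cong: if_cong)

lemma bil_eq_sum: "bil G X Y = (\<Sum>m\<in>UNIV. \<Sum>l\<in>UNIV. X $ m * G $ m $ l * Y $ l)"
  by (simp add: bil_def inner_vec_def matrix_vector_mult_def sum_distrib_left mult.assoc)

lemma bil_axis_right: "bil G X (axis l 1) = (\<Sum>m\<in>UNIV. X $ m * G $ m $ l)"
  by (simp add: bil_eq_sum axis_def sum_times_delta)

lemma bil_axes: "bil G (axis k 1) (axis l 1) = G $ k $ l"
  by (simp add: bil_axis_right) (simp add: axis_def sum_times_delta)

lemma linear_bil_left: "linear (\<lambda>X. bil G X Y)"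
  by (rule linearI) (simp_all add: bil_def inner_add_left)

lemma linear_bil_right: "linear (\<lambda>Y. bil G X Y)"
  by (rule linearI) (simp_all add: bil_def inner_add_right matrix_vector_right_distrib scaleR_matrix_vector_assoc[symmetric] matrix_vector_mult_scaleR)

lemma bil_commute:
  assumes "\<And>k l. G $ k $ l = G $ l $ k"
  shows "bil G X Y = bil G Y X"
  unfolding bil_eq_sum by (subst sum.swap) (simp add: assms[of _ "_ :: 'a"] mult.commute mult.left_commute)

lemma matrix_inv_inverse:
  fixes A :: "real^'n::finite^'n"
  assumes "invertible A"
  shows "A ** matrix_inv A = mat 1" "matrix_inv A ** A = mat 1"
  using someI_ex[OF assms[unfolded invertible_def]] by (simp_all add: matrix_inv_def)

lemma matrix_inv_unique:
  fixes A :: "real^'n::finite^'n"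
  assumes "A ** C = mat 1"
  shows "matrix_inv A = C"
proof -
  have "invertible A"
    using assms invertible_right_inverse by blast
  then have "matrix_inv A ** (A ** C) = C"
    by (simp add: matrix_mul_assoc matrix_inv_inverse)
  then show ?thesis using assms by simp
qed

lemma sum_matrix_inv:
  fixes A :: "real^'n::finite^'n"
  assumes "invertible A"
  shows "(\<Sum>k\<in>UNIV. A $ m $ k * matrix_inv A $ k $ l) = (if m = l then 1 else 0)"
  using matrix_inv_inverse(1)[OF assms]
  by (simp add: matrix_matrix_mult_def mat_def vec_eq_iff)

lemma matrix_inv_symmetric:
  fixes A :: "real^'n::finite^'n"
  assumes "invertible A" "transpose A = A"
  shows "transpose (matrix_inv A) = matrix_inv A"
proof -
  have "transpose (matrix_inv A ** A) = mat 1"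
    using matrix_inv_inverse(2)[OF assms(1)] by (simp add: transpose_mat)
  then have "A ** transpose (matrix_inv A) = mat 1"
    by (simp add: matrix_transpose_mul assms(2))
  then show ?thesis by (rule matrix_inv_unique[symmetric])
qed

lemma linear2_eq_0_on_axes:
  fixes H :: "real^'m::finite \<Rightarrow> real^'n::finite \<Rightarrow> real"
  assumes "\<And>y. linear (\<lambda>x. H x y)" "\<And>x. linear (\<lambda>y. H x y)"
    and "\<And>i j. H (axis i 1) (axis j 1) = 0"
  shows "H x y = 0"
  using linear_eq_0_on_axes[OF assms(2), of x] linear_eq_0_on_axes[OF assms(1)] assms(3) by blast

lemma linear4_eq_0_on_axes:
  fixes H :: "real^'n::finite \<Rightarrow> real^'n \<Rightarrow> real^'n \<Rightarrow> real^'n \<Rightarrow> real"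
  assumes "\<And>y z w. linear (\<lambda>x. H x y z w)" "\<And>x z w. linear (\<lambda>y. H x y z w)"
    and "\<And>x y w. linear (\<lambda>z. H x y z w)" "\<And>x y z. linear (\<lambda>w. H x y z w)"
    and "\<And>i j k l. H (axis i 1) (axis j 1) (axis k 1) (axis l 1) = 0"
  shows "H x y z w = 0"
  by (rule linear2_eq_0_on_axes[of "\<lambda>x y. H x y z w"], (rule assms)+,
      rule linear2_eq_0_on_axes[of "\<lambda>z w. H _ _ z w"], (rule assms)+)

lemma bil_nondegenerate:
  fixes G :: "real^'n::finite^'n"
  assumes "invertible G" "\<And>W. bil G X W = bil G Y W"
  shows "X = Y"
proof -
  have "X \<bullet> V = Y \<bullet> V" for V
    using assms(2)[of "matrix_inv G *v V"]
    by (simp add: bil_def matrix_vector_mul_assoc matrix_inv_inverse[OF assms(1)])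
  then show ?thesis using vector_eq_rdot by blast
qed

lemma sum_UNIV_sum:
  fixes h :: "'p::finite + 'q::finite \<Rightarrow> 'b::comm_monoid_add"
  shows "(\<Sum>k\<in>UNIV. h k) = (\<Sum>a\<in>UNIV. h (Inl a)) + (\<Sum>\<alpha>\<in>UNIV. h (Inr \<alpha>))"
  using sum.Plus[of "UNIV :: 'p set" "UNIV :: 'q set" h] by (simp add: o_def)

text \<open>Cramer's rule makes the inverse metric a rational function of the entries of the metric, hence
differentiable.\<close>

lemma matrix_inv_cramer:
  fixes A :: "real^'n::finite^'n"
  assumes "invertible A"
  shows "matrix_inv A $ k $ l = det (\<chi> i j. if j = k then axis l 1 $ i else A $ i $ j) / det A"
proof -
  have "det A \<noteq> 0" using assms by (simp add: invertible_det_nz)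
  have "A *v column l (matrix_inv A) = axis l 1"
  proof -
    have "A *v column l (matrix_inv A) = column l (A ** matrix_inv A)"
      by (simp add: vec_eq_iff column_def matrix_vector_mult_def matrix_matrix_mult_def)
    also have "\<dots> = axis l 1"
      by (simp add: matrix_inv_inverse[OF assms] vec_eq_iff column_def mat_def axis_def)
    finally show ?thesis .
  qed
  then have "column l (matrix_inv A) = (\<chi> k. det (\<chi> i j. if j = k then axis l 1 $ i else A $ i $ j) / det A)"
    using cramer[OF \<open>det A \<noteq> 0\<close>] by blast
  then show ?thesis by (simp add: vec_eq_iff column_def)
qed

lemma differentiable_prod_real:
  fixes h :: "'i \<Rightarrow> 'v::real_normed_vector \<Rightarrow> real"
  assumes "\<And>i. i \<in> I \<Longrightarrow> h i differentiable (at u)"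
  shows "(\<lambda>v. \<Prod>i\<in>I. h i v) differentiable (at u)"
  using assms by (induction I rule: infinite_finite_induct) auto

lemma differentiable_det:
  fixes A :: "'v::real_normed_vector \<Rightarrow> real^'n::finite^'n"
  assumes "\<And>k l. (\<lambda>v. A v $ k $ l) differentiable (at u)"
  shows "(\<lambda>v. det (A v)) differentiable (at u)"
  unfolding det_def
  by (intro differentiable_sum ballI differentiable_mult differentiable_prod_real assms) auto

section \<open>Algebraic curvature tensors\<close>

locale curvature_form =
  fixes R :: "'v::real_vector \<Rightarrow> 'v \<Rightarrow> 'v \<Rightarrow> 'v \<Rightarrow> real"
  assumes linear1: "linear (\<lambda>x. R x y z w)"
    and skew12: "R x y z w = - R y x z w"
    and skew34: "R x y z w = - R x y w z"
    and pair: "R x y z w = R z w x y"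
begin

lemma slot1: "R (x + x') y z w = R x y z w + R x' y z w" "R (c *\<^sub>R x) y z w = c * R x y z w"
    "R (- x) y z w = - R x y z w" "R (x - x') y z w = R x y z w - R x' y z w" "R 0 y z w = 0"
  using linear_add[OF linear1] linear_cmul[OF linear1] linear_neg[OF linear1]
    linear_diff[OF linear1] linear_0[OF linear1] by simp_all

lemma slot2: "R y (x + x') z w = R y x z w + R y x' z w" "R y (c *\<^sub>R x) z w = c * R y x z w"
    "R y (- x) z w = - R y x z w" "R y (x - x') z w = R y x z w - R y x' z w" "R y 0 z w = 0"
  unfolding skew12[of y] by (simp_all add: slot1)

lemma slot3: "R z w (x + x') y = R z w x y + R z w x' y" "R z w (c *\<^sub>R x) y = c * R z w x y"
    "R z w (- x) y = - R z w x y" "R z w (x - x') y = R z w x y - R z w x' y" "R z w 0 y = 0"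
  unfolding pair[of z w] by (simp_all add: slot1)

lemma slot4: "R z w y (x + x') = R z w y x + R z w y x'" "R z w y (c *\<^sub>R x) = c * R z w y x"
    "R z w y (- x) = - R z w y x" "R z w y (x - x') = R z w y x - R z w y x'" "R z w y 0 = 0"
  unfolding pair[of z w] by (simp_all add: slot2)

lemmas slots = slot1 slot2 slot3 slot4

end

locale symmetric_form =
  fixes h :: "'v::real_vector \<Rightarrow> 'v \<Rightarrow> real"
  assumes linear_left: "linear (\<lambda>x. h x y)"
    and commute: "h x y = h y x"
begin

lemma left: "h (x + x') y = h x y + h x' y" "h (c *\<^sub>R x) y = c * h x y" "h (- x) y = - h x y"
    "h (x - x') y = h x y - h x' y" "h 0 y = 0"
  using linear_add[OF linear_left] linear_cmul[OF linear_left] linear_neg[OF linear_left]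
    linear_diff[OF linear_left] linear_0[OF linear_left] by simp_all

lemma right: "h y (x + x') = h y x + h y x'" "h y (c *\<^sub>R x) = c * h y x" "h y (- x) = - h y x"
    "h y (x - x') = h y x - h y x'" "h y 0 = 0"
  unfolding commute[of y] by (simp_all add: left)

end

text \<open>The usual action \<open>R \<cdot> H\<close> is the negative of this with \<open>D = \<R>(X,Y)\<close>.\<close>

definition derivation4 :: "('v \<Rightarrow> 'v) \<Rightarrow> ('v \<Rightarrow> 'v \<Rightarrow> 'v \<Rightarrow> 'v \<Rightarrow> real) \<Rightarrow> 'v \<Rightarrow> 'v \<Rightarrow> 'v \<Rightarrow> 'v \<Rightarrow> real"
  where "derivation4 D H x1 x2 x3 x4 =
    H (D x1) x2 x3 x4 + H x1 (D x2) x3 x4 + H x1 x2 (D x3) x4 + H x1 x2 x3 (D x4)"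

text \<open>The tensor \<open>G\<close> of the metric \<open>h\<close>: the curvature tensor of constant curvature one.\<close>

definition wedge_square :: "('v \<Rightarrow> 'v \<Rightarrow> real) \<Rightarrow> 'v \<Rightarrow> 'v \<Rightarrow> 'v \<Rightarrow> 'v \<Rightarrow> real"
  where "wedge_square h u v w z = h u z * h v w - h u w * h v z"

locale curvature_operator = curvature_form R + h: symmetric_form h
  for R :: "'v::real_vector \<Rightarrow> 'v \<Rightarrow> 'v \<Rightarrow> 'v \<Rightarrow> real" and h :: "'v \<Rightarrow> 'v \<Rightarrow> real" +
  fixes r :: "'v \<Rightarrow> 'v \<Rightarrow> 'v \<Rightarrow> 'v"
  assumes lower: "h (r x y z) w = R x y z w"
    and nondegenerate: "(\<And>w. h x w = h y w) \<Longrightarrow> x = y"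
begin

lemma lower': "h w (r x y z) = R x y z w"
  by (simp add: h.commute[of w] lower)

lemma operator_zero: "r 0 y z = 0" "r x 0 z = 0" "r x y 0 = 0"
  by (rule nondegenerate, simp add: lower slots h.left)+

text \<open>Subtracting a constant curvature part. With \<open>\<kappa> = f \<Delta>\<close> this is the fiber block of the curvature of a
warped product.\<close>

definition shifted :: "real \<Rightarrow> 'v \<Rightarrow> 'v \<Rightarrow> 'v \<Rightarrow> 'v \<Rightarrow> real"
  where "shifted \<kappa> x y z w = R x y z w - \<kappa> * wedge_square h x y z w"

definition shifted_op :: "real \<Rightarrow> 'v \<Rightarrow> 'v \<Rightarrow> 'v \<Rightarrow> 'v"
  where "shifted_op \<kappa> x y z = r x y z - \<kappa> *\<^sub>R (h y z *\<^sub>R x - h x z *\<^sub>R y)"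

lemma shifted: "curvature_operator (shifted \<kappa>) h (shifted_op \<kappa>)"
proof (intro curvature_operator.intro curvature_form.intro curvature_operator_axioms.intro h.symmetric_form_axioms)
  fix x y z w
  show "linear (\<lambda>x. shifted \<kappa> x y z w)"
    by (rule linearI) (simp_all add: shifted_def wedge_square_def slots h.left algebra_simps)
  show "shifted \<kappa> x y z w = - shifted \<kappa> y x z w"
    using skew12[of x y z w] by (simp add: shifted_def wedge_square_def algebra_simps)
  show "shifted \<kappa> x y z w = - shifted \<kappa> x y w z"
    using skew34[of x y z w] by (simp add: shifted_def wedge_square_def algebra_simps)
  show "shifted \<kappa> x y z w = shifted \<kappa> z w x y"
    using pair[of x y z w] h.commute[of w x] h.commute[of z y] h.commute[of z x] h.commute[of w y]
    by (simp add: shifted_def wedge_square_def algebra_simps)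
  show "h (shifted_op \<kappa> x y z) w = shifted \<kappa> x y z w"
    by (simp add: shifted_def shifted_op_def wedge_square_def lower h.left algebra_simps)
qed (use nondegenerate in blast)

text \<open>An endomorphism that is skew with respect to \<open>h\<close> annihilates \<open>wedge_square h\<close>. So only its action on
\<open>R\<close> remains, and there the constant curvature part of the shifted operator contributes the Tachibana
tensor.\<close>

lemma derivation4_shifted:
  "derivation4 (shifted_op \<kappa> x y) (shifted \<kappa>) x1 x2 x3 x4 =
    derivation4 (r x y) R x1 x2 x3 x4
    + \<kappa> * (h x x1 * R y x2 x3 x4 - h y x1 * R x x2 x3 x4 + (h x x2 * R x1 y x3 x4 - h y x2 * R x1 x x3 x4)
      + (h x x3 * R x1 x2 y x4 - h y x3 * R x1 x2 x x4) + (h x x4 * R x1 x2 x3 y - h y x4 * R x1 x2 x3 x))"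
proof -
  interpret s: curvature_operator "shifted \<kappa>" h "shifted_op \<kappa>" by (rule shifted)
  have skew: "h (shifted_op \<kappa> x y v) w = - h v (shifted_op \<kappa> x y w)" for v w
    using s.skew34[of x y v w] by (simp add: s.lower s.lower')
  have "derivation4 (shifted_op \<kappa> x y) (wedge_square h) x1 x2 x3 x4 = 0"
    by (simp add: derivation4_def wedge_square_def skew algebra_simps)
  moreover have "derivation4 (shifted_op \<kappa> x y) (shifted \<kappa>) x1 x2 x3 x4 =
      derivation4 (shifted_op \<kappa> x y) R x1 x2 x3 x4 - \<kappa> * derivation4 (shifted_op \<kappa> x y) (wedge_square h) x1 x2 x3 x4"
    unfolding derivation4_def shifted_def by (simp add: algebra_simps)
  ultimately have "derivation4 (shifted_op \<kappa> x y) (shifted \<kappa>) x1 x2 x3 x4 = derivation4 (shifted_op \<kappa> x y) R x1 x2 x3 x4"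
    by simp
  then show ?thesis
    by (simp add: derivation4_def shifted_op_def slots algebra_simps)
qed

end

text \<open>Reduces identities between curvature tensors to components.\<close>

lemma curvature_form_eq_on_axes:
  fixes R R' :: "real^'n::finite \<Rightarrow> real^'n \<Rightarrow> real^'n \<Rightarrow> real^'n \<Rightarrow> real"
  assumes "curvature_form R" "curvature_form R'"
    and "\<And>i j k l. R (axis i 1) (axis j 1) (axis k 1) (axis l 1) = R' (axis i 1) (axis j 1) (axis k 1) (axis l 1)"
  shows "R x y z w = R' x y z w"
proof -
  interpret R: curvature_form R by fact
  interpret R': curvature_form R' by fact
  have "R x y z w - R' x y z w = 0"
    by (rule linear4_eq_0_on_axes; (rule linearI)?) (simp_all add: R.slots R'.slots assms(3) algebra_simps)
  then show ?thesis by simp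
qed

lemma curvature_form_compose:
  assumes "curvature_form R" "linear L"
  shows "curvature_form (\<lambda>x y z w. R (L x) (L y) (L z) (L w))"
proof -
  interpret R: curvature_form R by fact
  interpret L: linear L by fact
  show ?thesis
    by (intro curvature_form.intro linearI R.skew12 R.skew34 R.pair)
      (simp_all add: L.add L.scale R.slots)
qed

lemma symmetric_form_bil:
  fixes G :: "real^'n::finite^'n"
  assumes "transpose G = G"
  shows "symmetric_form (bil G)"
proof (rule symmetric_form.intro)
  show "linear (\<lambda>x. bil G x y)" for y by (rule linear_bil_left)
  show "bil G x y = bil G y x" for x y
    using assms by (intro bil_commute) (simp add: transpose_def vec_eq_iff)
qed

section \<open>The curvature tensor in a chart\<close>

text \<open>Christoffel symbols of the first kind, \<open>[ij,k]\<close>.\<close>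

definition christoffel1 :: "(real^'n::finite \<Rightarrow> real^'n^'n) \<Rightarrow> real^'n \<Rightarrow> 'n \<Rightarrow> 'n \<Rightarrow> 'n \<Rightarrow> real"
  where "christoffel1 g u i j k =
    (pd i (\<lambda>v. g v $ j $ k) u + pd j (\<lambda>v. g v $ i $ k) u - pd k (\<lambda>v. g v $ i $ j) u) / 2"

lemma christoffel_eq: "christoffel g u k i j = (\<Sum>l\<in>UNIV. matrix_inv (g u) $ k $ l * christoffel1 g u i j l)"
  unfolding christoffel_def christoffel1_def sum_distrib_left
  by (intro sum.cong) auto

text \<open>The fully covariant curvature tensor in terms of second derivatives of the metric. All three
symmetries of the curvature tensor are visible in this form.\<close>

definition lowered_curv :: "(real^'n::finite \<Rightarrow> real^'n^'n) \<Rightarrow> real^'n \<Rightarrow> 'n \<Rightarrow> 'n \<Rightarrow> 'n \<Rightarrow> 'n \<Rightarrow> real"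
  where "lowered_curv g u i j k l =
    (pd i (pd k (\<lambda>v. g v $ j $ l)) u + pd j (pd l (\<lambda>v. g v $ i $ k)) u
      - pd i (pd l (\<lambda>v. g v $ j $ k)) u - pd j (pd k (\<lambda>v. g v $ i $ l)) u) / 2
    + (\<Sum>m\<in>UNIV. \<Sum>n\<in>UNIV. matrix_inv (g u) $ m $ n *
        (christoffel1 g u j l m * christoffel1 g u i k n - christoffel1 g u i l m * christoffel1 g u j k n))"

locale metric_patch =
  fixes S :: "(real^'n::finite) set" and g :: "real^'n \<Rightarrow> real^'n^'n"
  assumes open_S: "open S"
    and twice: "\<And>k l. twice_differentiable_on S (\<lambda>u. g u $ k $ l)"
    and sym: "\<And>u. u \<in> S \<Longrightarrow> transpose (g u) = g u"
    and inv: "\<And>u. u \<in> S \<Longrightarrow> invertible (g u)"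
begin

lemma sym_nth: "u \<in> S \<Longrightarrow> g u $ k $ l = g u $ l $ k"
  using sym[of u] by (simp add: transpose_def vec_eq_iff) 

lemma inv_sym_nth: "u \<in> S \<Longrightarrow> matrix_inv (g u) $ k $ l = matrix_inv (g u) $ l $ k"
  using matrix_inv_symmetric[OF inv sym, of u] by (simp add: transpose_def vec_eq_iff)

lemma diff_g: "u \<in> S \<Longrightarrow> (\<lambda>u. g u $ k $ l) differentiable (at u)"
  and diff_pd_g: "u \<in> S \<Longrightarrow> pd i (\<lambda>u. g u $ k $ l) differentiable (at u)"
  using twice[of k l] by (auto simp: twice_differentiable_on_def)

lemma pd_g_sym: "u \<in> S \<Longrightarrow> pd i (\<lambda>v. g v $ k $ l) u = pd i (\<lambda>v. g v $ l $ k) u"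
  using open_S by (rule pd_cong_open) (auto simp: sym_nth)

lemma pd2_g_sym: "u \<in> S \<Longrightarrow> pd j (pd i (\<lambda>v. g v $ k $ l)) u = pd j (pd i (\<lambda>v. g v $ l $ k)) u"
  using open_S by (rule pd_cong_open) (auto simp: pd_g_sym)

lemma pd2_g_commute: "u \<in> S \<Longrightarrow> pd j (pd i (\<lambda>v. g v $ k $ l)) u = pd i (pd j (\<lambda>v. g v $ k $ l)) u"
  using open_S twice by (intro twice_differentiable_on_commute)

lemma christoffel1_sym: "u \<in> S \<Longrightarrow> christoffel1 g u i j k = christoffel1 g u j i k"
  unfolding christoffel1_def using pd_g_sym[of u k i j] by simp

lemma christoffel_sym: "u \<in> S \<Longrightarrow> christoffel g u k i j = christoffel g u k j i"
  unfolding christoffel_eq by (simp add: christoffel1_sym)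

lemma pd_g_eq_christoffel1:
  "u \<in> S \<Longrightarrow> pd i (\<lambda>v. g v $ k $ l) u = christoffel1 g u i k l + christoffel1 g u i l k"
  unfolding christoffel1_def using pd_g_sym[of u i k l] by (simp add: field_simps)

lemma diff_christoffel1: "u \<in> S \<Longrightarrow> (\<lambda>v. christoffel1 g v i j k) differentiable (at u)"
  unfolding christoffel1_def by (simp add: diff_pd_g)

lemma diff_matrix_inv:
  assumes "u \<in> S"
  shows "(\<lambda>v. matrix_inv (g v) $ k $ l) differentiable (at u)"
proof (rule differentiable_transform_open[OF _ open_S assms])
  have "det (g u) \<noteq> 0" using inv[OF assms] by (simp add: invertible_det_nz)
  moreover have "(\<lambda>v. (\<chi> i j. if j = k then axis l 1 $ i else g v $ i $ j) $ m $ n) differentiable (at u)" for m n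
    by (cases "n = k") (simp_all add: diff_g[OF assms])
  ultimately show "(\<lambda>v. det (\<chi> i j. if j = k then axis l 1 $ i else g v $ i $ j) / det (g v)) differentiable (at u)"
    by (intro differentiable_divide differentiable_det diff_g[OF assms])
qed (simp add: matrix_inv_cramer inv)

lemma diff_christoffel: "u \<in> S \<Longrightarrow> (\<lambda>v. christoffel g v k i j) differentiable (at u)"
  unfolding christoffel_eq by (simp add: diff_christoffel1 diff_matrix_inv)

lemma lower_christoffel:
  assumes "u \<in> S"
  shows "(\<Sum>k\<in>UNIV. g u $ l $ k * christoffel g u k i j) = christoffel1 g u i j l"
proof -
  have "(\<Sum>k\<in>UNIV. g u $ l $ k * christoffel g u k i j) =
      (\<Sum>m\<in>UNIV. (\<Sum>k\<in>UNIV. g u $ l $ k * matrix_inv (g u) $ k $ m) * christoffel1 g u i j m)"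
    unfolding christoffel_eq sum_distrib_left sum_distrib_right by (subst sum.swap) (simp add: mult.assoc)
  then show ?thesis
    by (simp add: sum_matrix_inv[OF inv[OF assms]] sum_times_delta)
qed

text \<open>The components \<open>R\<^sup>l\<^sub>i\<^sub>j\<^sub>k\<close>: the component \<open>l\<close> of \<open>\<R>(\<partial>\<^sub>i,\<partial>\<^sub>j)\<partial>\<^sub>k\<close>.\<close>

definition curv_coeff :: "real^'n \<Rightarrow> 'n \<Rightarrow> 'n \<Rightarrow> 'n \<Rightarrow> 'n \<Rightarrow> real"
  where "curv_coeff u i j k l =
    pd i (\<lambda>v. christoffel g v l j k) u - pd j (\<lambda>v. christoffel g v l i k) u
    + (\<Sum>m\<in>UNIV. christoffel g u l i m * christoffel g u m j k - christoffel g u l j m * christoffel g u m i k)"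

lemma cov_deriv_const:
  "cov_deriv g (\<lambda>_. X) (\<lambda>_. Y) v $ k = (\<Sum>i\<in>UNIV. \<Sum>j\<in>UNIV. christoffel g v k i j * X $ i * Y $ j)"
  by (simp add: cov_deriv_def)

lemma cov_deriv_cov_deriv_const:
  assumes u: "u \<in> S"
  shows "cov_deriv g (\<lambda>_. X) (cov_deriv g (\<lambda>_. Y) (\<lambda>_. Z)) u $ l =
    (\<Sum>i\<in>UNIV. \<Sum>j\<in>UNIV. \<Sum>k\<in>UNIV. X $ i * Y $ j * Z $ k *
      (pd i (\<lambda>v. christoffel g v l j k) u + (\<Sum>m\<in>UNIV. christoffel g u l i m * christoffel g u m j k)))"
proof -
  let ?W = "cov_deriv g (\<lambda>_. Y) (\<lambda>_. Z)"
  have dn: "(\<lambda>v. ?W v $ k) differentiable (at u)" for k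
    unfolding cov_deriv_const by (simp add: diff_christoffel[OF u])
  have d: "?W differentiable (at u)"
  proof -
    have "\<exists>D. ((\<lambda>v. ?W v $ k) has_derivative D) (at u)" for k
      using dn[of k] by (auto simp: differentiable_def)
    then obtain D where D: "\<And>k. ((\<lambda>v. ?W v $ k) has_derivative D k) (at u)" by metis
    have "((\<lambda>v. \<Sum>k\<in>UNIV. ?W v $ k *\<^sub>R axis k 1) has_derivative (\<lambda>h. \<Sum>k\<in>UNIV. D k h *\<^sub>R axis k 1)) (at u)"
      by (intro has_derivative_sum has_derivative_scaleR_left D)
    moreover have "(\<lambda>v. \<Sum>k\<in>UNIV. ?W v $ k *\<^sub>R axis k 1) = ?W"
      using basis_expansion[of "?W _"] by (simp add: fun_eq_iff scalar_mult_eq_scaleR)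
    ultimately have "(?W has_derivative (\<lambda>h. \<Sum>k\<in>UNIV. D k h *\<^sub>R axis k 1)) (at u)"
      by (rule back_subst[of "\<lambda>W. (W has_derivative _) (at u)"])
    then show ?thesis by (rule Derivative.differentiableI)
  qed
  have pdW: "pd i (\<lambda>v. ?W v $ l) u = (\<Sum>j\<in>UNIV. \<Sum>k\<in>UNIV. Y $ j * Z $ k * pd i (\<lambda>v. christoffel g v l j k) u)" for i
  proof -
    have "pd i (\<lambda>v. ?W v $ l) u = pd i (\<lambda>v. \<Sum>j\<in>UNIV. \<Sum>k\<in>UNIV. (Y $ j * Z $ k) * christoffel g v l j k) u"
      unfolding cov_deriv_const by (simp add: mult_ac)
    also have "\<dots> = (\<Sum>j\<in>UNIV. \<Sum>k\<in>UNIV. Y $ j * Z $ k * pd i (\<lambda>v. christoffel g v l j k) u)"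
      by (subst pd_sum pd_cmult, simp add: diff_christoffel[OF u])+ (simp add: diff_christoffel[OF u] pd_cmult)
    finally show ?thesis .
  qed
  have "cov_deriv g (\<lambda>_. X) ?W u $ l = (\<Sum>i\<in>UNIV. X $ i * pd i (\<lambda>v. ?W v $ l) u)
      + (\<Sum>i\<in>UNIV. \<Sum>m\<in>UNIV. christoffel g u l i m * X $ i * ?W u $ m)"
    unfolding cov_deriv_def[of g "\<lambda>_. X"]
    by (simp add: frechet_derivative_nth[OF d] frechet_derivative_eq_sum_pd[OF dn])
  also have "(\<Sum>i\<in>UNIV. X $ i * pd i (\<lambda>v. ?W v $ l) u) =
      (\<Sum>i\<in>UNIV. \<Sum>j\<in>UNIV. \<Sum>k\<in>UNIV. X $ i * Y $ j * Z $ k * pd i (\<lambda>v. christoffel g v l j k) u)"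
    by (simp add: pdW sum_distrib_left mult_ac)
  also have "(\<Sum>i\<in>UNIV. \<Sum>m\<in>UNIV. christoffel g u l i m * X $ i * ?W u $ m) =
      (\<Sum>i\<in>UNIV. \<Sum>m\<in>UNIV. \<Sum>j\<in>UNIV. \<Sum>k\<in>UNIV. X $ i * Y $ j * Z $ k * (christoffel g u l i m * christoffel g u m j k))"
    unfolding cov_deriv_const by (simp add: sum_distrib_left mult_ac)
  also have "\<dots> = (\<Sum>i\<in>UNIV. \<Sum>j\<in>UNIV. \<Sum>k\<in>UNIV. X $ i * Y $ j * Z $ k * (\<Sum>m\<in>UNIV. christoffel g u l i m * christoffel g u m j k))"
    unfolding sum_distrib_left
    by (rule sum.cong[OF refl], subst sum.swap, rule sum.cong[OF refl], subst sum.swap) simp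
  finally show ?thesis
    by (simp add: sum.distrib ring_distribs)
qed

lemma curv_at_nth:
  assumes u: "u \<in> S"
  shows "curv_at g u X Y Z $ l = (\<Sum>i\<in>UNIV. \<Sum>j\<in>UNIV. \<Sum>k\<in>UNIV. X $ i * Y $ j * Z $ k * curv_coeff u i j k l)"
proof -
  have "lie_bracket (\<lambda>_. X) (\<lambda>_. Y) = (\<lambda>_. 0)"
    by (simp add: lie_bracket_def fun_eq_iff)
  then have "cov_deriv g (lie_bracket (\<lambda>_. X) (\<lambda>_. Y)) (\<lambda>_. Z) u = 0"
    by (simp add: vec_eq_iff cov_deriv_const)
  then have "curv_at g u X Y Z $ l =
     (\<Sum>i\<in>UNIV. \<Sum>j\<in>UNIV. \<Sum>k\<in>UNIV. X $ i * Y $ j * Z $ k *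
      (pd i (\<lambda>v. christoffel g v l j k) u + (\<Sum>m\<in>UNIV. christoffel g u l i m * christoffel g u m j k))) -
     (\<Sum>j\<in>UNIV. \<Sum>i\<in>UNIV. \<Sum>k\<in>UNIV. Y $ j * X $ i * Z $ k *
      (pd j (\<lambda>v. christoffel g v l i k) u + (\<Sum>m\<in>UNIV. christoffel g u l j m * christoffel g u m i k)))"
    by (simp add: curv_at_def curv_field_def cov_deriv_cov_deriv_const[OF u])
  then show ?thesis
    by (subst (asm) (2) sum.swap) (simp add: curv_coeff_def sum_subtractf sum.distrib ring_distribs mult_ac)
qed

lemma curv_at_linear:
  assumes "u \<in> S"
  shows "linear (\<lambda>X. curv_at g u X Y Z)" "linear (\<lambda>Y. curv_at g u X Y Z)" "linear (\<lambda>Z. curv_at g u X Y Z)"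
  by (rule linearI; simp add: vec_eq_iff curv_at_nth[OF assms] sum.distrib ring_distribs sum_distrib_left mult_ac)+

lemma curv_at_axes:
  assumes "u \<in> S"
  shows "curv_at g u (axis i 1) (axis j 1) (axis k 1) $ l = curv_coeff u i j k l"
proof -
  have "curv_at g u (axis i 1) (axis j 1) (axis k 1) $ l = (\<Sum>i'\<in>UNIV. (if i' = i then 1 else 0) *
    (\<Sum>j'\<in>UNIV. (if j' = j then 1 else 0) * (\<Sum>k'\<in>UNIV. (if k' = k then 1 else 0) * curv_coeff u i' j' k' l)))"
    unfolding curv_at_nth[OF assms] sum_distrib_left by (simp add: axis_def mult.assoc)
  then show ?thesis by (simp only: sum_times_delta)
qed


text \<open>Differentiating \<open>g\<^sub>l\<^sub>m \<Gamma>\<^sup>m\<^sub>j\<^sub>k = [jk,l]\<close> instead of the Christoffel symbols themselves trades the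
derivative of the inverse metric for derivatives of \<open>g\<^sub>l\<^sub>m\<close>, which are sums of two first kind symbols.\<close>

theorem bil_curv_at_axes:
  assumes u: "u \<in> S"
  shows "bil (g u) (curv_at g u (axis i 1) (axis j 1) (axis k 1)) (axis l 1) = lowered_curv g u i j k l"
proof -
  have A: "(\<Sum>m\<in>UNIV. g u $ l $ m * pd i (\<lambda>v. christoffel g v m j k) u) =
      pd i (\<lambda>v. christoffel1 g v j k l) u
      - (\<Sum>m\<in>UNIV. (christoffel1 g u i l m + christoffel1 g u i m l) * christoffel g u m j k)" for i j k
  proof -
    have "pd i (\<lambda>v. christoffel1 g v j k l) u = pd i (\<lambda>v. \<Sum>m\<in>UNIV. g v $ l $ m * christoffel g v m j k) u"
      using open_S u by (rule pd_cong_open) (simp add: lower_christoffel)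
    also have "\<dots> = (\<Sum>m\<in>UNIV. pd i (\<lambda>v. g v $ l $ m * christoffel g v m j k) u)"
      by (intro pd_sum) (simp add: diff_g[OF u] diff_christoffel[OF u])
    also have "\<dots> = (\<Sum>m\<in>UNIV. (christoffel1 g u i l m + christoffel1 g u i m l) * christoffel g u m j k
        + g u $ l $ m * pd i (\<lambda>v. christoffel g v m j k) u)"
      by (simp add: pd_mult diff_g[OF u] diff_christoffel[OF u] pd_g_eq_christoffel1[OF u])
    finally show ?thesis by (simp add: sum.distrib)
  qed
  have B: "(\<Sum>m\<in>UNIV. g u $ l $ m * (\<Sum>n\<in>UNIV. christoffel g u m i n * christoffel g u n j k)) =
      (\<Sum>n\<in>UNIV. christoffel1 g u i n l * christoffel g u n j k)" for i j k
  proof -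
    have "(\<Sum>m\<in>UNIV. g u $ l $ m * (\<Sum>n\<in>UNIV. christoffel g u m i n * christoffel g u n j k)) =
        (\<Sum>n\<in>UNIV. (\<Sum>m\<in>UNIV. g u $ l $ m * christoffel g u m i n) * christoffel g u n j k)"
      unfolding sum_distrib_left sum_distrib_right by (subst sum.swap) (simp add: mult.assoc)
    then show ?thesis by (simp add: lower_christoffel[OF u])
  qed
  have C: "pd i (\<lambda>v. christoffel1 g v j k l) u = (pd i (pd j (\<lambda>v. g v $ k $ l)) u
      + pd i (pd k (\<lambda>v. g v $ j $ l)) u - pd i (pd l (\<lambda>v. g v $ j $ k)) u) / 2" for i j k
    using pd_cmult[of "\<lambda>v. pd j (\<lambda>v. g v $ k $ l) v + pd k (\<lambda>v. g v $ j $ l) v - pd l (\<lambda>v. g v $ j $ k) v" u i "1/2"]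
    by (simp add: christoffel1_def pd_add pd_diff diff_pd_g[OF u])
  have "bil (g u) (curv_at g u (axis i 1) (axis j 1) (axis k 1)) (axis l 1) =
      (\<Sum>m\<in>UNIV. g u $ l $ m * curv_coeff u i j k m)"
    by (simp add: bil_axis_right curv_at_axes[OF u] sym_nth[OF u, of _ l] mult.commute)
  also have "\<dots> = (\<Sum>m\<in>UNIV. g u $ l $ m * pd i (\<lambda>v. christoffel g v m j k) u)
      - (\<Sum>m\<in>UNIV. g u $ l $ m * pd j (\<lambda>v. christoffel g v m i k) u)
      + (\<Sum>m\<in>UNIV. g u $ l $ m * (\<Sum>n\<in>UNIV. christoffel g u m i n * christoffel g u n j k))
      - (\<Sum>m\<in>UNIV. g u $ l $ m * (\<Sum>n\<in>UNIV. christoffel g u m j n * christoffel g u n i k))"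
    by (simp add: curv_coeff_def sum_subtractf sum.distrib algebra_simps)
  also have "\<dots> = pd i (\<lambda>v. christoffel1 g v j k l) u - pd j (\<lambda>v. christoffel1 g v i k l) u
      + (\<Sum>m\<in>UNIV. christoffel1 g u j l m * christoffel g u m i k - christoffel1 g u i l m * christoffel g u m j k)"
    unfolding A B by (simp add: sum_subtractf sum.distrib algebra_simps)
  also have "(\<Sum>m\<in>UNIV. christoffel1 g u j l m * christoffel g u m i k - christoffel1 g u i l m * christoffel g u m j k)
      = (\<Sum>m\<in>UNIV. \<Sum>n\<in>UNIV. matrix_inv (g u) $ m $ n *
        (christoffel1 g u j l m * christoffel1 g u i k n - christoffel1 g u i l m * christoffel1 g u j k n))"
    unfolding christoffel_eq by (simp add: sum_subtractf sum_distrib_left algebra_simps)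
  finally show ?thesis
    unfolding C lowered_curv_def using pd2_g_commute[OF u, of j i k l] by (simp add: field_simps)
qed

lemma lowered_curv_skew12: "lowered_curv g u i j k l = - lowered_curv g u j i k l"
  unfolding lowered_curv_def by (simp add: sum_subtractf algebra_simps add_divide_distrib diff_divide_distrib)

lemma lowered_curv_skew34:
  assumes u: "u \<in> S"
  shows "lowered_curv g u i j k l = - lowered_curv g u i j l k"
proof -
  have "(\<Sum>m\<in>UNIV. \<Sum>n\<in>UNIV. matrix_inv (g u) $ m $ n *
        (christoffel1 g u j l m * christoffel1 g u i k n - christoffel1 g u i l m * christoffel1 g u j k n))
     = - (\<Sum>n\<in>UNIV. \<Sum>m\<in>UNIV. matrix_inv (g u) $ n $ m *
        (christoffel1 g u j k n * christoffel1 g u i l m - christoffel1 g u i k n * christoffel1 g u j l m))"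
    by (subst sum.swap) (simp add: sum_negf[symmetric] inv_sym_nth[OF u, of _ "_ :: 'n"] algebra_simps)
  then show ?thesis
    unfolding lowered_curv_def by (simp add: field_simps)
qed

lemma lowered_curv_pair:
  assumes u: "u \<in> S"
  shows "lowered_curv g u i j k l = lowered_curv g u k l i j"
proof -
  have sw: "(\<Sum>m\<in>UNIV. \<Sum>n\<in>UNIV. matrix_inv (g u) $ m $ n * (christoffel1 g u i l m * christoffel1 g u j k n))
      = (\<Sum>m\<in>UNIV. \<Sum>n\<in>UNIV. matrix_inv (g u) $ m $ n * (christoffel1 g u k j m * christoffel1 g u l i n))"
    by (subst sum.swap) (simp add: inv_sym_nth[OF u, of _ "_ :: 'n"] christoffel1_sym[OF u, of k j] christoffel1_sym[OF u, of l i] mult_ac)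
  show ?thesis
    unfolding lowered_curv_def right_diff_distrib sum_subtractf sw
    by (simp add: pd2_g_commute[OF u, of k i] pd2_g_commute[OF u, of l j] pd2_g_commute[OF u, of k j] pd2_g_commute[OF u, of l i]
       pd2_g_sym[OF u, of _ _ l j] pd2_g_sym[OF u, of _ _ k i] pd2_g_sym[OF u, of _ _ l i] pd2_g_sym[OF u, of _ _ k j]
       christoffel1_sym[OF u, of l j] christoffel1_sym[OF u, of k i])
qed

end

text \<open>The contraction \<open>g\<^sup>m\<^sup>n [ij,m] [kl,n]\<close>. The quadratic part of the curvature is a difference of two such
terms, so that for a warped product they can be evaluated block by block.\<close>

definition christoffel_square :: "(real^'n::finite \<Rightarrow> real^'n^'n) \<Rightarrow> real^'n \<Rightarrow> 'n \<Rightarrow> 'n \<Rightarrow> 'n \<Rightarrow> 'n \<Rightarrow> real"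
  where "christoffel_square g u i j k l =
    (\<Sum>m\<in>UNIV. \<Sum>n\<in>UNIV. matrix_inv (g u) $ m $ n * (christoffel1 g u i j m * christoffel1 g u k l n))"

lemma lowered_curv_eq:
  "lowered_curv g u i j k l =
    (pd i (pd k (\<lambda>v. g v $ j $ l)) u + pd j (pd l (\<lambda>v. g v $ i $ k)) u
      - pd i (pd l (\<lambda>v. g v $ j $ k)) u - pd j (pd k (\<lambda>v. g v $ i $ l)) u) / 2
    + christoffel_square g u j l i k - christoffel_square g u i l j k"
  by (simp add: lowered_curv_def christoffel_square_def sum_subtractf right_diff_distrib)

lemma (in metric_patch) christoffel_square_commute:
  "u \<in> S \<Longrightarrow> christoffel_square g u i j k l = christoffel_square g u k l i j"
  unfolding christoffel_square_def
  by (subst sum.swap) (simp add: inv_sym_nth[of u _ "_ :: 'n"] mult.commute)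

text \<open>Metric and inverse metric cancel. This applies whenever one of two contracted first kind symbols is
a multiple of the metric, as the symbols mixing base and fiber are.\<close>

lemma (in metric_patch) contract_left:
  assumes "u \<in> S"
  shows "(\<Sum>m\<in>UNIV. \<Sum>n\<in>UNIV. matrix_inv (g u) $ m $ n * (g u $ k $ m * c n)) = c k"
proof -
  have "(\<Sum>m\<in>UNIV. \<Sum>n\<in>UNIV. matrix_inv (g u) $ m $ n * (g u $ k $ m * c n)) =
      (\<Sum>n\<in>UNIV. (\<Sum>m\<in>UNIV. g u $ k $ m * matrix_inv (g u) $ m $ n) * c n)"
    unfolding sum_distrib_right by (subst sum.swap) (simp add: mult_ac)
  then show ?thesis by (simp add: sum_matrix_inv[OF inv[OF assms]] sum_times_delta)
qed

text \<open>The symmetries of \<open>lowered_curv\<close> hold for components; multilinearity extends them to all vectors.\<close>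

lemma (in metric_patch) curvature_operator:
  assumes u: "u \<in> S"
  shows "curvature_operator (\<lambda>X Y Z W. bil (g u) (curv_at g u X Y Z) W) (bil (g u)) (curv_at g u)"
proof (intro curvature_operator.intro curvature_form.intro curvature_operator_axioms.intro refl)
  let ?R = "\<lambda>X Y Z W. bil (g u) (curv_at g u X Y Z) W"
  note lins = linear_compose[OF curv_at_linear(1)[OF u] linear_bil_left, unfolded o_def]
     linear_compose[OF curv_at_linear(2)[OF u] linear_bil_left, unfolded o_def]
     linear_compose[OF curv_at_linear(3)[OF u] linear_bil_left, unfolded o_def]
     linear_bil_right
  show "linear (\<lambda>x. ?R x y z w)" for y z w by (rule lins)
  show "?R x y z w = - ?R y x z w" for x y z w
  proof -
    have "?R x y z w + ?R y x z w = 0"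
      by (rule linear4_eq_0_on_axes[where H = "\<lambda>x y z w. ?R x y z w + ?R y x z w"], (rule linear_compose_add lins)+)
        (use lowered_curv_skew12 in \<open>simp add: bil_curv_at_axes[OF u] eq_neg_iff_add_eq_0\<close>)
    then show ?thesis by simp
  qed
  show "?R x y z w = - ?R x y w z" for x y z w
  proof -
    have "?R x y z w + ?R x y w z = 0"
      by (rule linear4_eq_0_on_axes[where H = "\<lambda>x y z w. ?R x y z w + ?R x y w z"], (rule linear_compose_add lins)+)
        (use lowered_curv_skew34[OF u] in \<open>simp add: bil_curv_at_axes[OF u] eq_neg_iff_add_eq_0\<close>)
    then show ?thesis by simp
  qed
  show "?R x y z w = ?R z w x y" for x y z w
  proof -
    have "?R x y z w - ?R z w x y = 0"
      by (rule linear4_eq_0_on_axes[where H = "\<lambda>x y z w. ?R x y z w - ?R z w x y"], (rule linear_compose_sub lins)+)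
        (use lowered_curv_pair[OF u] in \<open>simp add: bil_curv_at_axes[OF u]\<close>)
    then show ?thesis by simp
  qed
  show "symmetric_form (bil (g u))" using sym[OF u] by (rule symmetric_form_bil)
  show "x = y" if "\<And>w. bil (g u) x w = bil (g u) y w" for x y
    using inv[OF u] that by (rule bil_nondegenerate)
qed

section \<open>The algebraic criterion\<close>

text \<open>The curvature of a warped product at a point, abstractly: \<open>\<phi>\<close> is the value of the warping function,
\<open>p\<close> the fiber curvature with a constant curvature part subtracted, and \<open>\<tau>\<close> is \<open>T\<close> with one index raised
by the base metric \<open>gb\<close>. Tangent vectors are pairs of a base and a fiber vector.\<close>

locale warped_curvature =
  base: curvature_operator Rb gb rb + fiber: curvature_operator p h P + T: symmetric_form T
  for Rb :: "'b::real_vector \<Rightarrow> 'b \<Rightarrow> 'b \<Rightarrow> 'b \<Rightarrow> real" and gb rb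
    and p :: "'c::real_vector \<Rightarrow> 'c \<Rightarrow> 'c \<Rightarrow> 'c \<Rightarrow> real" and h P
    and T :: "'b \<Rightarrow> 'b \<Rightarrow> real" +
  fixes \<tau> :: "'b \<Rightarrow> 'b" and \<phi> :: real
  assumes raise: "gb (\<tau> x) y = T x y"
    and \<phi>: "\<phi> \<noteq> 0"
    and nontrivial: "\<exists>u :: 'c. u \<noteq> 0"
begin

lemma T_\<tau>: "T (\<tau> x) y = T x (\<tau> y)"
  by (metis T.commute base.h.commute raise)

lemma T_\<tau>': "T x (\<tau> y) = T y (\<tau> x)"
  using T_\<tau>[of y x] T.commute[of x "\<tau> y"] by simp

lemma T_rb': "T w (rb x y z) = Rb x y z (\<tau> w)"
  using raise[of w "rb x y z"] base.lower' by simp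

lemma T_rb: "T (rb x y z) w = Rb x y z (\<tau> w)"
  by (simp add: T.commute[of _ w] T_rb')

lemma h_nonzero: "\<exists>u v. h u v \<noteq> 0"
  using nontrivial fiber.nondegenerate by (metis fiber.h.left(5))

text \<open>The mixed terms form the Kulkarni-Nomizu product of \<open>T\<close> and the fiber metric \<open>h\<close>; \<open>\<phi>\<close> multiplies all
fiber terms because the metric on the fiber directions is \<open>\<phi> h\<close>.\<close>

definition total_form :: "'b \<times> 'c \<Rightarrow> 'b \<times> 'c \<Rightarrow> 'b \<times> 'c \<Rightarrow> 'b \<times> 'c \<Rightarrow> real"
  where "total_form X1 X2 X3 X4 = Rb (fst X1) (fst X2) (fst X3) (fst X4) + \<phi> * p (snd X1) (snd X2) (snd X3) (snd X4)
    - \<phi> * (T (fst X2) (fst X3) * h (snd X1) (snd X4) + T (fst X1) (fst X4) * h (snd X2) (snd X3)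
      - T (fst X1) (fst X3) * h (snd X2) (snd X4) - T (fst X2) (fst X4) * h (snd X1) (snd X3))"

definition total_op :: "'b \<times> 'c \<Rightarrow> 'b \<times> 'c \<Rightarrow> 'b \<times> 'c \<Rightarrow> 'b \<times> 'c"
  where "total_op X Y Z =
    (rb (fst X) (fst Y) (fst Z) - (\<phi> * h (snd Y) (snd Z)) *\<^sub>R \<tau> (fst X) + (\<phi> * h (snd X) (snd Z)) *\<^sub>R \<tau> (fst Y),
     P (snd X) (snd Y) (snd Z) - T (fst Y) (fst Z) *\<^sub>R snd X + T (fst X) (fst Z) *\<^sub>R snd Y)"

lemma lower_total_op: "gb (fst (total_op X Y Z)) (fst W) + \<phi> * h (snd (total_op X Y Z)) (snd W) = total_form X Y Z W"
  by (simp add: total_op_def total_form_def base.h.left fiber.h.left base.lower fiber.lower raise algebra_simps)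

text \<open>Necessity follows by inserting vectors tangent to one of the factors. For sufficiency, the second condition turns every occurrence of \<open>Rb\<close> with an argument \<open>\<tau> x\<close>,
in particular the action of \<open>rb\<close> on \<open>T\<close>, into a polynomial in \<open>T\<close>; all these polynomials cancel and what
is left is a combination of instances of the three other conditions.\<close>

theorem semisymmetric_iff:
  "(\<forall>X Y X1 X2 X3 X4. derivation4 (total_op X Y) total_form X1 X2 X3 X4 = 0) \<longleftrightarrow>
    (\<forall>x y x1 x2 x3 x4. derivation4 (rb x y) Rb x1 x2 x3 x4 = 0) \<and>
    (\<forall>x y z w. T y x * T z w - T y w * T z x + Rb y z w (\<tau> x) = 0) \<and>
    (\<forall>x y u v w z. T x y * p u v w z + \<phi> * T x (\<tau> y) * wedge_square h u v w z = 0) \<and>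
    (\<forall>u v u1 u2 u3 u4. derivation4 (P u v) p u1 u2 u3 u4 = 0)"
  (is "?L \<longleftrightarrow> ?I \<and> ?II \<and> ?III \<and> ?IV")
proof
  assume L: ?L
  note simps = derivation4_def total_op_def total_form_def base.slots fiber.slots T.left T.right fiber.h.left fiber.h.right base.operator_zero fiber.operator_zero
  have ?I
  proof (intro allI)
    fix x y x1 x2 x3 x4
    show "derivation4 (rb x y) Rb x1 x2 x3 x4 = 0"
      using L[THEN spec, of "(x, 0)", THEN spec, of "(y, 0)", THEN spec, of "(x1, 0)",
          THEN spec, of "(x2, 0)", THEN spec, of "(x3, 0)", THEN spec, of "(x4, 0)"]
      by (simp add: simps)
  qed
  moreover have ?IV
  proof (intro allI)
    fix u v u1 u2 u3 u4
    have "\<phi> * derivation4 (P u v) p u1 u2 u3 u4 = 0"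
      using L[THEN spec, of "(0, u)", THEN spec, of "(0, v)", THEN spec, of "(0, u1)",
          THEN spec, of "(0, u2)", THEN spec, of "(0, u3)", THEN spec, of "(0, u4)"]
      by (simp add: simps distrib_left)
    then show "derivation4 (P u v) p u1 u2 u3 u4 = 0"
      using \<phi> by simp
  qed
  moreover have ?II
  proof (intro allI)
    fix x y z w
    obtain u v where uv: "h u v \<noteq> 0" using h_nonzero by blast
    have "(\<phi> * h u v) * (T y x * T z w - T y w * T z x + Rb y z w (\<tau> x)) = 0"
      using L[THEN spec, of "(0, u)", THEN spec, of "(x, 0)", THEN spec, of "(y, 0)",
          THEN spec, of "(z, 0)", THEN spec, of "(w, 0)", THEN spec, of "(0, v)"] 
      by (simp add: simps T.commute[of x] algebra_simps)
    then show "T y x * T z w - T y w * T z x + Rb y z w (\<tau> x) = 0"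
      using \<phi> uv by simp
  qed
  moreover have ?III
  proof (intro allI)
    fix x y u v w z
    have "\<phi> * (T x y * p u v w z + \<phi> * T x (\<tau> y) * wedge_square h u v w z) = 0"
      using L[THEN spec, of "(0, u)", THEN spec, of "(y, 0)", THEN spec, of "(x, 0)",
          THEN spec, of "(0, v)", THEN spec, of "(0, w)", THEN spec, of "(0, z)"]
      by (simp add: simps T.commute[of y] wedge_square_def algebra_simps)
    then show "T x y * p u v w z + \<phi> * T x (\<tau> y) * wedge_square h u v w z = 0"
      using \<phi> by simp
  qed
  ultimately show "?I \<and> ?II \<and> ?III \<and> ?IV" by blast
next
  assume R: "?I \<and> ?II \<and> ?III \<and> ?IV"
  note I = R[THEN conjunct1] and II = R[THEN conjunct2, THEN conjunct1]
    and III = R[THEN conjunct2, THEN conjunct2, THEN conjunct1]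
    and IV = R[THEN conjunct2, THEN conjunct2, THEN conjunct2]
  \<comment> \<open>The second condition, moved to each of the four slots by the curvature symmetries.\<close>
  have b4: "Rb y z w (\<tau> x) = T y w * T z x - T y x * T z w" for x y z w
    using II by (simp add: algebra_simps add_eq_0_iff)
  have b3: "Rb y z (\<tau> x) w = T y x * T z w - T y w * T z x" for x y z w
    using base.skew34[of y z "\<tau> x" w] by (simp add: b4)
  have b2: "Rb y (\<tau> x) z w = T z y * T w x - T z x * T w y" for x y z w
    using base.pair[of y "\<tau> x" z w] by (simp add: b4)
  have b1: "Rb (\<tau> x) y z w = T z x * T w y - T z y * T w x" for x y z w
    using base.pair[of "\<tau> x" y z w] by (simp add: b3)
  note simps = derivation4_def total_op_def total_form_def base.slots fiber.slots T.left T.right fiber.h.left fiber.h.right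
  show ?L
  proof (intro allI)
    fix X Y X1 X2 X3 X4 :: "'b \<times> 'c"
    obtain x u y v where XY: "X = (x, u)" "Y = (y, v)" by (cases X, cases Y) blast
    obtain x1 u1 x2 u2 x3 u3 x4 u4 where Xs: "X1 = (x1, u1)" "X2 = (x2, u2)" "X3 = (x3, u3)" "X4 = (x4, u4)"
      by (cases X1, cases X2, cases X3, cases X4) blast
    \<comment> \<open>The third condition occurs once for each slot and each of \<open>X\<close>, \<open>Y\<close>: the base part of one and the fiber part of the other.\<close>
    let ?C = "\<lambda>x y u v w z. T x y * p u v w z + \<phi> * T x (\<tau> y) * wedge_square h u v w z"
    have "derivation4 (total_op X Y) total_form X1 X2 X3 X4 =
      derivation4 (rb x y) Rb x1 x2 x3 x4 + \<phi> * derivation4 (P u v) p u1 u2 u3 u4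
      + \<phi> * (?C x x1 v u2 u3 u4 + ?C x x2 u1 v u3 u4 + ?C x x3 u1 u2 v u4 + ?C x x4 u1 u2 u3 v)
      - \<phi> * (?C y x1 u u2 u3 u4 + ?C y x2 u1 u u3 u4 + ?C y x3 u1 u2 u u4 + ?C y x4 u1 u2 u3 u)"
      unfolding XY Xs derivation4_def
      by (simp add: total_op_def total_form_def base.slots fiber.slots T.left T.right fiber.h.left fiber.h.right b1 b2 b3 b4
          T_rb T_rb' fiber.lower fiber.lower' fiber.skew34[of u v u4] fiber.skew34[of u v u3 u1] fiber.skew34[of u v u3 u2] fiber.skew34[of u v u2 u1]
          T_\<tau> T_\<tau>'[of x1] T_\<tau>'[of x2] T_\<tau>'[of x3] T_\<tau>'[of x4]
          T.commute[of _ x] T.commute[of _ y] T.commute[of x2 x1] T.commute[of x3 x1] T.commute[of x4 x1] T.commute[of x3 x2] T.commute[of x4 x2] T.commute[of x4 x3]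
          fiber.h.commute[of u] fiber.h.commute[of v]
          fiber.h.commute[of u2 u1] fiber.h.commute[of u3 u1] fiber.h.commute[of u4 u1] fiber.h.commute[of u3 u2] fiber.h.commute[of u4 u2] fiber.h.commute[of u4 u3]
          wedge_square_def algebra_simps)
    also have "\<dots> = 0" using I III IV by simp
    finally show "derivation4 (total_op X Y) total_form X1 X2 X3 X4 = 0" .
  qed
qed

end

lemma (in warped_curvature) curvature_form_total: "curvature_form total_form"
proof (rule curvature_form.intro)
  show "linear (\<lambda>x. total_form x y z w)" for y z w
    by (rule linearI) (simp_all add: total_form_def base.slots fiber.slots T.left fiber.h.left algebra_simps)
  show "total_form x y z w = - total_form y x z w" for x y z w
    using base.skew12[of "fst x" "fst y" "fst z" "fst w"] fiber.skew12[of "snd x" "snd y" "snd z" "snd w"]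
    by (simp add: total_form_def algebra_simps)
  show "total_form x y z w = - total_form x y w z" for x y z w
    using base.skew34[of "fst x" "fst y" "fst z" "fst w"] fiber.skew34[of "snd x" "snd y" "snd z" "snd w"]
    by (simp add: total_form_def algebra_simps)
  show "total_form x y z w = total_form z w x y" for x y z w
    using base.pair[of "fst x" "fst y" "fst z" "fst w"] fiber.pair[of "snd x" "snd y" "snd z" "snd w"]
    by (simp add: total_form_def T.commute[of "fst w" "fst x"] T.commute[of "fst w" "fst y"] T.commute[of "fst z" "fst x"] T.commute[of "fst z" "fst y"]
       fiber.h.commute[of "snd w" "snd x"] fiber.h.commute[of "snd w" "snd y"] fiber.h.commute[of "snd z" "snd x"] fiber.h.commute[of "snd z" "snd y"] algebra_simps)
qed

section \<open>The metric of a warped product in product coordinates\<close>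

lemma base_part_nth [simp]: "base_part w $ a = w $ Inl a"
  and fiber_part_nth [simp]: "fiber_part w $ \<alpha> = w $ Inr \<alpha>"
  by (simp_all add: base_part_def fiber_part_def)

lemma linear_base_part: "linear base_part"
  and linear_fiber_part: "linear fiber_part"
  by (auto intro!: linearI simp: vec_eq_iff)

lemma bounded_linear_base_part: "bounded_linear base_part"
  and bounded_linear_fiber_part: "bounded_linear fiber_part"
  using linear_base_part linear_fiber_part by (simp_all add: linear_conv_bounded_linear)

lemma base_part_axis [simp]: "base_part (axis (Inl a) c) = axis a c" "base_part (axis (Inr \<alpha>) c) = 0"
  and fiber_part_axis [simp]: "fiber_part (axis (Inr \<alpha>) c) = axis \<alpha> c" "fiber_part (axis (Inl a) c) = 0"
  by (auto simp: vec_eq_iff axis_def)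

lemma base_part_join [simp]: "base_part (join u v) = u"
  and fiber_part_join [simp]: "fiber_part (join u v) = v"
  by (simp_all add: vec_eq_iff join_def)

lemma pullback_form_base:
  "pullback_form base_part G $ Inl a $ Inl b = G $ a $ b"
  "pullback_form base_part G $ Inl a $ Inr \<beta> = 0"
  "pullback_form base_part G $ Inr \<alpha> $ k = 0"
  by (simp_all add: pullback_form_def bil_axes) (simp_all add: bil_def)

lemma pullback_form_fiber:
  "pullback_form fiber_part G $ Inr \<alpha> $ Inr \<beta> = G $ \<alpha> $ \<beta>"
  "pullback_form fiber_part G $ Inr \<alpha> $ Inl b = 0"
  "pullback_form fiber_part G $ Inl a $ k = 0"
  by (simp_all add: pullback_form_def bil_axes) (simp_all add: bil_def)

definition parts :: "real^('p::finite + 'q::finite) \<Rightarrow> (real^'p) \<times> (real^'q)"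
  where "parts X = (base_part X, fiber_part X)"

lemma linear_parts: "linear parts"
  by (rule linearI) (simp_all add: parts_def linear_add[OF linear_base_part] linear_add[OF linear_fiber_part]
      linear_cmul[OF linear_base_part] linear_cmul[OF linear_fiber_part])

lemma parts_join: "parts (join u v) = (u, v)" by (simp add: parts_def)

text \<open>The matrix of the warped product metric in a product chart, with the warping function and the two
metrics given by their local representatives.\<close>

definition warped_metric :: "(real^'p::finite \<Rightarrow> real^'p^'p) \<Rightarrow> (real^'p \<Rightarrow> real) \<Rightarrow> (real^'q::finite \<Rightarrow> real^'q^'q)
    \<Rightarrow> real^('p + 'q) \<Rightarrow> real^('p + 'q)^('p + 'q)"
  where "warped_metric gB \<psi> gF w = pullback_form base_part (gB (base_part w)) +
      \<psi> (base_part w) *\<^sub>R pullback_form fiber_part (gF (fiber_part w))"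

text \<open>The factor \<open>1\<close> presents the base block, like the fiber block, as a function on the base times a
function on the fiber, so that the product rules below apply to all blocks alike.\<close>

lemma warped_metric_nth:
  "warped_metric gB \<psi> gF w $ Inl a $ Inl b = gB (base_part w) $ a $ b * 1"
  "warped_metric gB \<psi> gF w $ Inr \<alpha> $ Inr \<beta> = \<psi> (base_part w) * gF (fiber_part w) $ \<alpha> $ \<beta>"
  "warped_metric gB \<psi> gF w $ Inl a $ Inr \<beta> = 0"
  "warped_metric gB \<psi> gF w $ Inr \<alpha> $ Inl b = 0"
  by (simp_all add: warped_metric_def pullback_form_base pullback_form_fiber)

lemma bil_warped_metric:
  "bil (warped_metric gB \<psi> gF w) X Y = bil (gB (base_part w)) (base_part X) (base_part Y)
    + \<psi> (base_part w) * bil (gF (fiber_part w)) (fiber_part X) (fiber_part Y)"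
  by (simp add: bil_eq_sum sum_UNIV_sum warped_metric_nth sum_distrib_left mult_ac)

context
  fixes h :: "real^'p::finite \<Rightarrow> real" and k :: "real^'q::finite \<Rightarrow> real" and w :: "real^('p + 'q)"
  assumes h: "h differentiable (at (base_part w))" and k: "k differentiable (at (fiber_part w))"
begin

lemma has_derivative_product:
  "((\<lambda>w. h (base_part w) * k (fiber_part w)) has_derivative
    (\<lambda>X. h (base_part w) * frechet_derivative k (at (fiber_part w)) (fiber_part X)
      + frechet_derivative h (at (base_part w)) (base_part X) * k (fiber_part w))) (at w)"
proof -
  have b: "(base_part has_derivative base_part) (at w)" 
    by (intro bounded_linear_imp_has_derivative bounded_linear_base_part)
  have f: "(fiber_part has_derivative fiber_part) (at w)" 
    by (intro bounded_linear_imp_has_derivative bounded_linear_fiber_part)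
  have "((\<lambda>w. h (base_part w)) has_derivative (\<lambda>X. frechet_derivative h (at (base_part w)) (base_part X))) (at w)"
    using h by (intro has_derivative_compose[OF b]) (simp add: frechet_derivative_works)
  moreover have "((\<lambda>w. k (fiber_part w)) has_derivative (\<lambda>X. frechet_derivative k (at (fiber_part w)) (fiber_part X))) (at w)"
    using k by (intro has_derivative_compose[OF f]) (simp add: frechet_derivative_works)
  ultimately show ?thesis by (rule has_derivative_mult)
qed

lemma differentiable_product: "(\<lambda>w. h (base_part w) * k (fiber_part w)) differentiable (at w)"
  using has_derivative_product by (rule Derivative.differentiableI)

lemma pd_product:
  "pd (Inl a) (\<lambda>w. h (base_part w) * k (fiber_part w)) w = pd a h (base_part w) * k (fiber_part w)"
  "pd (Inr \<alpha>) (\<lambda>w. h (base_part w) * k (fiber_part w)) w = h (base_part w) * pd \<alpha> k (fiber_part w)"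
  unfolding pd_eqI[OF has_derivative_product]
  using linear_0[OF linear_frechet_derivative[OF h]] linear_0[OF linear_frechet_derivative[OF k]]
  by (simp_all add: pd_def)

end

definition product_dom :: "(real^'p::finite) set \<Rightarrow> (real^'q::finite) set \<Rightarrow> (real^('p + 'q)) set"
  where "product_dom U V = {w. base_part w \<in> U \<and> fiber_part w \<in> V}"

lemma open_product_dom:
  assumes "open U" "open V"
  shows "open (product_dom U V)"
proof -
  have "product_dom U V = base_part -` U \<inter> fiber_part -` V"
    by (auto simp: product_dom_def)
  moreover have "continuous_on UNIV base_part" "continuous_on UNIV fiber_part"
    by (intro linear_continuous_on bounded_linear_base_part bounded_linear_fiber_part)+
  ultimately show ?thesis
    using assms by (metis open_Int open_vimage)
qed

context
  fixes U :: "(real^'p::finite) set" and V :: "(real^'q::finite) set" and h k and w :: "real^('p + 'q)"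
  assumes UV: "open U" "open V" and h: "twice_differentiable_on U h" and k: "twice_differentiable_on V k"
    and w: "w \<in> product_dom U V"
begin

lemma pd_pd_product:
  "pd (Inl b) (pd (Inl a) (\<lambda>w. h (base_part w) * k (fiber_part w))) w = pd b (pd a h) (base_part w) * k (fiber_part w)"
  "pd (Inr \<beta>) (pd (Inl a) (\<lambda>w. h (base_part w) * k (fiber_part w))) w = pd a h (base_part w) * pd \<beta> k (fiber_part w)"
  "pd (Inl b) (pd (Inr \<alpha>) (\<lambda>w. h (base_part w) * k (fiber_part w))) w = pd b h (base_part w) * pd \<alpha> k (fiber_part w)"
  "pd (Inr \<beta>) (pd (Inr \<alpha>) (\<lambda>w. h (base_part w) * k (fiber_part w))) w = h (base_part w) * pd \<beta> (pd \<alpha> k) (fiber_part w)"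
proof -
  have 1: "pd i (pd (Inl a) (\<lambda>w. h (base_part w) * k (fiber_part w))) w = pd i (\<lambda>w. pd a h (base_part w) * k (fiber_part w)) w" for i a
    using open_product_dom[OF UV] w h k
    by (intro pd_cong_open) (auto simp: pd_product twice_differentiable_on_def product_dom_def)
  have 2: "pd i (pd (Inr \<alpha>) (\<lambda>w. h (base_part w) * k (fiber_part w))) w = pd i (\<lambda>w. h (base_part w) * pd \<alpha> k (fiber_part w)) w" for i \<alpha>
    using open_product_dom[OF UV] w h k
    by (intro pd_cong_open) (auto simp: pd_product twice_differentiable_on_def product_dom_def)
  show "pd (Inl b) (pd (Inl a) (\<lambda>w. h (base_part w) * k (fiber_part w))) w = pd b (pd a h) (base_part w) * k (fiber_part w)"
    "pd (Inr \<beta>) (pd (Inl a) (\<lambda>w. h (base_part w) * k (fiber_part w))) w = pd a h (base_part w) * pd \<beta> k (fiber_part w)"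
    "pd (Inl b) (pd (Inr \<alpha>) (\<lambda>w. h (base_part w) * k (fiber_part w))) w = pd b h (base_part w) * pd \<alpha> k (fiber_part w)"
    "pd (Inr \<beta>) (pd (Inr \<alpha>) (\<lambda>w. h (base_part w) * k (fiber_part w))) w = h (base_part w) * pd \<beta> (pd \<alpha> k) (fiber_part w)"
    unfolding 1 2 using h k w
    by (auto simp: pd_product twice_differentiable_on_def product_dom_def)
qed

end

lemma twice_differentiable_on_product:
  assumes UV: "open U" "open V" and h: "twice_differentiable_on U h" and k: "twice_differentiable_on V k"
  shows "twice_differentiable_on (product_dom U V) (\<lambda>w. h (base_part w) * k (fiber_part w))"
  unfolding twice_differentiable_on_def
proof (intro ballI conjI allI)
  fix w i assume w: "w \<in> product_dom U V"
  then show "(\<lambda>w. h (base_part w) * k (fiber_part w)) differentiable (at w)"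
    using h k by (auto intro!: differentiable_product simp: twice_differentiable_on_def product_dom_def)
  show "pd i (\<lambda>w. h (base_part w) * k (fiber_part w)) differentiable (at w)"
  proof (cases i)
    case (Inl a)
    have "(\<lambda>w. pd a h (base_part w) * k (fiber_part w)) differentiable (at w)"
      using h k w by (auto intro!: differentiable_product simp: twice_differentiable_on_def product_dom_def)
    then show ?thesis
      by (rule differentiable_transform_open[OF _ open_product_dom[OF UV] w])
        (use h k in \<open>auto simp: Inl pd_product twice_differentiable_on_def product_dom_def\<close>)
  next
    case (Inr \<alpha>)
    have "(\<lambda>w. h (base_part w) * pd \<alpha> k (fiber_part w)) differentiable (at w)"
      using h k w by (auto intro!: differentiable_product simp: twice_differentiable_on_def product_dom_def)
    then show ?thesis
      by (rule differentiable_transform_open[OF _ open_product_dom[OF UV] w])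
        (use h k in \<open>auto simp: Inr pd_product twice_differentiable_on_def product_dom_def\<close>)
  qed
qed

section \<open>The curvature of a warped product\<close>

locale warped_patch = base: metric_patch U gB + fiber: metric_patch V gF
  for U :: "(real^'p::finite) set" and gB and V :: "(real^'q::finite) set" and gF +
  fixes \<psi> :: "real^'p \<Rightarrow> real"
  assumes twice_\<psi>: "twice_differentiable_on U \<psi>"
    and \<psi>_nonzero: "u \<in> U \<Longrightarrow> \<psi> u \<noteq> 0"
begin

abbreviation "gW \<equiv> warped_metric gB \<psi> gF"

abbreviation "W \<equiv> product_dom U V"

text \<open>The inverse is again a warped metric: invert both blocks and the warping function.\<close>

lemma matrix_inv_gW:
  assumes "w \<in> W"
  shows "matrix_inv (gW w) = warped_metric (\<lambda>u. matrix_inv (gB u)) (\<lambda>u. 1 / \<psi> u) (\<lambda>v. matrix_inv (gF v)) w" (is "_ = ?C")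
    and "invertible (gW w)"
proof -
  have w: "base_part w \<in> U" "fiber_part w \<in> V" using assms by (auto simp: product_dom_def)
  have "(\<Sum>m\<in>UNIV. gW w $ k $ m * ?C $ m $ l) = (if k = l then 1 else 0)" for k l
  proof -
    have "(\<Sum>m\<in>UNIV. \<psi> (base_part w) * gF (fiber_part w) $ \<alpha> $ m * (1 / \<psi> (base_part w) * matrix_inv (gF (fiber_part w)) $ m $ \<beta>))
      = (\<Sum>m\<in>UNIV. gF (fiber_part w) $ \<alpha> $ m * matrix_inv (gF (fiber_part w)) $ m $ \<beta>)" for \<alpha> \<beta>
      using \<psi>_nonzero[OF w(1)] by simp
    then show ?thesis
      by (cases k; cases l) (simp_all add: sum_UNIV_sum warped_metric_nth sum_matrix_inv[OF base.inv[OF w(1)]]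
          sum_matrix_inv[OF fiber.inv[OF w(2)]] del: times_divide_eq_left)
  qed
  then have 1: "gW w ** ?C = mat 1"
    by (simp add: vec_eq_iff matrix_matrix_mult_def mat_def)
  then show "matrix_inv (gW w) = ?C" by (rule matrix_inv_unique)
  show "invertible (gW w)" using 1 invertible_right_inverse by blast
qed

sublocale total: metric_patch W gW
proof
  show "open W" using base.open_S fiber.open_S by (rule open_product_dom)
  show "twice_differentiable_on W (\<lambda>w. gW w $ k $ l)" for k l
    using twice_differentiable_on_product[OF base.open_S fiber.open_S base.twice twice_differentiable_on_const]
      twice_differentiable_on_product[OF base.open_S fiber.open_S twice_\<psi> fiber.twice]
    by (cases k; cases l) (simp_all only: warped_metric_nth twice_differentiable_on_const)
  show "transpose (gW w) = gW w" if "w \<in> W" for w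
  proof -
    have "gW w $ k $ l = gW w $ l $ k" for k l
      using that by (cases k; cases l)
        (auto simp: warped_metric_nth product_dom_def base.sym_nth fiber.sym_nth)
    then show ?thesis by (simp add: transpose_def vec_eq_iff)
  qed
qed (rule matrix_inv_gW(2))

text \<open>The tensor \<open>T\<close>. Where \<open>\<psi> > 0\<close> and \<open>F = sqrt \<psi>\<close>, it is \<open>Hess F / F\<close>, and \<open>warp_delta\<close> is \<open>|grad F|\<^sup>2 / F\<^sup>2\<close>.\<close>

definition hessT :: "real^'p \<Rightarrow> real^'p^'p"
  where "hessT u = (\<chi> a b. 1 / (2 * \<psi> u) *
    (pd b (pd a \<psi>) u - (\<Sum>c\<in>UNIV. christoffel gB u c a b * pd c \<psi> u) - 1 / (2 * \<psi> u) * pd a \<psi> u * pd b \<psi> u))"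

definition warp_delta :: "real^'p \<Rightarrow> real"
  where "warp_delta u = 1 / (4 * (\<psi> u)\<^sup>2) * (\<Sum>a\<in>UNIV. \<Sum>b\<in>UNIV. matrix_inv (gB u) $ a $ b * pd a \<psi> u * pd b \<psi> u)"

lemma transpose_hessT: "u \<in> U \<Longrightarrow> transpose (hessT u) = hessT u"
  unfolding hessT_def transpose_def
  by (simp add: vec_eq_iff base.christoffel_sym twice_differentiable_on_commute[OF base.open_S _ twice_\<psi>] mult.commute mult.left_commute)

context
  fixes w assumes w: "w \<in> W"
begin

private lemma u: "base_part w \<in> U" and v: "fiber_part w \<in> V"
  using w by (auto simp: product_dom_def)

lemma pd_gW:
  "pd (Inl c) (\<lambda>w. gW w $ Inl a $ Inl b) w = pd c (\<lambda>u. gB u $ a $ b) (base_part w)"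
  "pd (Inr \<gamma>) (\<lambda>w. gW w $ Inl a $ Inl b) w = 0"
  "pd (Inl c) (\<lambda>w. gW w $ Inr \<alpha> $ Inr \<beta>) w = pd c \<psi> (base_part w) * gF (fiber_part w) $ \<alpha> $ \<beta>"
  "pd (Inr \<gamma>) (\<lambda>w. gW w $ Inr \<alpha> $ Inr \<beta>) w = \<psi> (base_part w) * pd \<gamma> (\<lambda>v. gF v $ \<alpha> $ \<beta>) (fiber_part w)"
  "pd k (\<lambda>w. gW w $ Inl a $ Inr \<beta>) w = 0"
  "pd k (\<lambda>w. gW w $ Inr \<alpha> $ Inl b) w = 0"
proof -
  have \<psi>: "\<psi> differentiable (at (base_part w))"
    using twice_\<psi> u by (simp add: twice_differentiable_on_def)
  note pds = pd_product[OF base.diff_g[OF u] differentiable_const] pd_product[OF \<psi> fiber.diff_g[OF v]]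
  show "pd (Inl c) (\<lambda>w. gW w $ Inl a $ Inl b) w = pd c (\<lambda>u. gB u $ a $ b) (base_part w)"
    "pd (Inr \<gamma>) (\<lambda>w. gW w $ Inl a $ Inl b) w = 0"
    "pd (Inl c) (\<lambda>w. gW w $ Inr \<alpha> $ Inr \<beta>) w = pd c \<psi> (base_part w) * gF (fiber_part w) $ \<alpha> $ \<beta>"
    "pd (Inr \<gamma>) (\<lambda>w. gW w $ Inr \<alpha> $ Inr \<beta>) w = \<psi> (base_part w) * pd \<gamma> (\<lambda>v. gF v $ \<alpha> $ \<beta>) (fiber_part w)"
    "pd k (\<lambda>w. gW w $ Inl a $ Inr \<beta>) w = 0"
    "pd k (\<lambda>w. gW w $ Inr \<alpha> $ Inl b) w = 0"
    unfolding warped_metric_nth pds by simp_all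
qed

lemma pd_pd_gW:
  "pd (Inl d) (pd (Inl c) (\<lambda>w. gW w $ Inl a $ Inl b)) w = pd d (pd c (\<lambda>u. gB u $ a $ b)) (base_part w)"
  "pd (Inl d) (pd (Inr \<gamma>) (\<lambda>w. gW w $ Inl a $ Inl b)) w = 0"
  "pd (Inr \<delta>) (pd k (\<lambda>w. gW w $ Inl a $ Inl b)) w = 0"
  "pd (Inl d) (pd (Inl c) (\<lambda>w. gW w $ Inr \<alpha> $ Inr \<beta>)) w = pd d (pd c \<psi>) (base_part w) * gF (fiber_part w) $ \<alpha> $ \<beta>"
  "pd (Inr \<gamma>) (pd (Inl c) (\<lambda>w. gW w $ Inr \<alpha> $ Inr \<beta>)) w = pd c \<psi> (base_part w) * pd \<gamma> (\<lambda>v. gF v $ \<alpha> $ \<beta>) (fiber_part w)"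
  "pd (Inl c) (pd (Inr \<gamma>) (\<lambda>w. gW w $ Inr \<alpha> $ Inr \<beta>)) w = pd c \<psi> (base_part w) * pd \<gamma> (\<lambda>v. gF v $ \<alpha> $ \<beta>) (fiber_part w)"
  "pd (Inr \<delta>) (pd (Inr \<gamma>) (\<lambda>w. gW w $ Inr \<alpha> $ Inr \<beta>)) w = \<psi> (base_part w) * pd \<delta> (pd \<gamma> (\<lambda>v. gF v $ \<alpha> $ \<beta>)) (fiber_part w)"
  "pd l (pd k (\<lambda>w. gW w $ Inl a $ Inr \<beta>)) w = 0"
  "pd l (pd k (\<lambda>w. gW w $ Inr \<alpha> $ Inl b)) w = 0"
proof -
  note base = pd_pd_product[OF base.open_S fiber.open_S base.twice twice_differentiable_on_const w]
  note fiber = pd_pd_product[OF base.open_S fiber.open_S twice_\<psi> fiber.twice w]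
  show "pd (Inl d) (pd (Inl c) (\<lambda>w. gW w $ Inl a $ Inl b)) w = pd d (pd c (\<lambda>u. gB u $ a $ b)) (base_part w)"
    "pd (Inl d) (pd (Inr \<gamma>) (\<lambda>w. gW w $ Inl a $ Inl b)) w = 0"
    "pd (Inl d) (pd (Inl c) (\<lambda>w. gW w $ Inr \<alpha> $ Inr \<beta>)) w = pd d (pd c \<psi>) (base_part w) * gF (fiber_part w) $ \<alpha> $ \<beta>"
    "pd (Inr \<gamma>) (pd (Inl c) (\<lambda>w. gW w $ Inr \<alpha> $ Inr \<beta>)) w = pd c \<psi> (base_part w) * pd \<gamma> (\<lambda>v. gF v $ \<alpha> $ \<beta>) (fiber_part w)"
    "pd (Inl c) (pd (Inr \<gamma>) (\<lambda>w. gW w $ Inr \<alpha> $ Inr \<beta>)) w = pd c \<psi> (base_part w) * pd \<gamma> (\<lambda>v. gF v $ \<alpha> $ \<beta>) (fiber_part w)"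
    "pd (Inr \<delta>) (pd (Inr \<gamma>) (\<lambda>w. gW w $ Inr \<alpha> $ Inr \<beta>)) w = \<psi> (base_part w) * pd \<delta> (pd \<gamma> (\<lambda>v. gF v $ \<alpha> $ \<beta>)) (fiber_part w)"
    "pd l (pd k (\<lambda>w. gW w $ Inl a $ Inr \<beta>)) w = 0"
    "pd l (pd k (\<lambda>w. gW w $ Inr \<alpha> $ Inl b)) w = 0"
    unfolding warped_metric_nth base fiber pd_const_fun by simp_all
  show "pd (Inr \<delta>) (pd k (\<lambda>w. gW w $ Inl a $ Inl b)) w = 0"
    by (cases k) (simp_all only: warped_metric_nth base pd_const_fun mult_zero_right)
qed

lemma christoffel1_gW:
  "christoffel1 gW w (Inl a) (Inl b) (Inl c) = christoffel1 gB (base_part w) a b c"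
  "christoffel1 gW w (Inl a) (Inl b) (Inr \<gamma>) = 0"
  "christoffel1 gW w (Inl a) (Inr \<beta>) (Inl c) = 0"
  "christoffel1 gW w (Inr \<alpha>) (Inl b) (Inl c) = 0"
  "christoffel1 gW w (Inl a) (Inr \<beta>) (Inr \<gamma>) = pd a \<psi> (base_part w) / 2 * gF (fiber_part w) $ \<beta> $ \<gamma>"
  "christoffel1 gW w (Inr \<alpha>) (Inl b) (Inr \<gamma>) = pd b \<psi> (base_part w) / 2 * gF (fiber_part w) $ \<alpha> $ \<gamma>"
  "christoffel1 gW w (Inr \<alpha>) (Inr \<beta>) (Inl c) = - (pd c \<psi> (base_part w) / 2 * gF (fiber_part w) $ \<alpha> $ \<beta>)"
  "christoffel1 gW w (Inr \<alpha>) (Inr \<beta>) (Inr \<gamma>) = \<psi> (base_part w) * christoffel1 gF (fiber_part w) \<alpha> \<beta> \<gamma>"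
  by (simp_all add: christoffel1_def pd_gW algebra_simps)

lemma christoffel_square_gW:
  "christoffel_square gW w (Inl a) (Inl b) (Inl c) (Inl d) = christoffel_square gB (base_part w) a b c d"
  "christoffel_square gW w (Inl a) (Inl b) (Inl c) (Inr \<delta>) = 0"
  "christoffel_square gW w (Inl a) (Inl b) (Inr \<gamma>) (Inl d) = 0"
  "christoffel_square gW w (Inl a) (Inl b) (Inr \<gamma>) (Inr \<delta>) =
    - (gF (fiber_part w) $ \<gamma> $ \<delta> / 2 * (\<Sum>c\<in>UNIV. christoffel gB (base_part w) c a b * pd c \<psi> (base_part w)))"
  "christoffel_square gW w (Inl a) (Inr \<beta>) (Inl c) (Inr \<delta>) =
    pd a \<psi> (base_part w) * pd c \<psi> (base_part w) / (4 * \<psi> (base_part w)) * gF (fiber_part w) $ \<beta> $ \<delta>"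
  "christoffel_square gW w (Inl a) (Inr \<beta>) (Inr \<gamma>) (Inl d) =
    pd a \<psi> (base_part w) * pd d \<psi> (base_part w) / (4 * \<psi> (base_part w)) * gF (fiber_part w) $ \<beta> $ \<gamma>"
  "christoffel_square gW w (Inr \<alpha>) (Inl b) (Inr \<gamma>) (Inl d) =
    pd b \<psi> (base_part w) * pd d \<psi> (base_part w) / (4 * \<psi> (base_part w)) * gF (fiber_part w) $ \<alpha> $ \<gamma>"
  "christoffel_square gW w (Inr \<alpha>) (Inl b) (Inr \<gamma>) (Inr \<delta>) =
    pd b \<psi> (base_part w) / 2 * christoffel1 gF (fiber_part w) \<gamma> \<delta> \<alpha>"
  "christoffel_square gW w (Inr \<alpha>) (Inr \<beta>) (Inr \<gamma>) (Inr \<delta>) =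
    \<psi> (base_part w) * christoffel_square gF (fiber_part w) \<alpha> \<beta> \<gamma> \<delta>
    + (\<psi> (base_part w))\<^sup>2 * warp_delta (base_part w) * (gF (fiber_part w) $ \<alpha> $ \<beta> * gF (fiber_part w) $ \<gamma> $ \<delta>)"
proof -
  let ?u = "base_part w" and ?v = "fiber_part w"
  have \<psi>: "\<psi> ?u \<noteq> 0" using u by (rule \<psi>_nonzero)
  have split: "christoffel_square gW w i j k l =
     (\<Sum>m\<in>UNIV. \<Sum>n\<in>UNIV. matrix_inv (gB ?u) $ m $ n * (christoffel1 gW w i j (Inl m) * christoffel1 gW w k l (Inl n)))
     + 1 / \<psi> ?u * (\<Sum>m\<in>UNIV. \<Sum>n\<in>UNIV. matrix_inv (gF ?v) $ m $ n * (christoffel1 gW w i j (Inr m) * christoffel1 gW w k l (Inr n)))"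
    for i j k l
    unfolding christoffel_square_def matrix_inv_gW(1)[OF w]
    by (simp add: sum_UNIV_sum warped_metric_nth sum_distrib_left)
  have contract: "(\<Sum>m\<in>UNIV. \<Sum>n\<in>UNIV. matrix_inv (gF ?v) $ m $ n * (c * gF ?v $ \<alpha> $ m * e n)) = c * e \<alpha>" for c e \<alpha>
    using fiber.contract_left[OF v, of \<alpha> e] by (simp add: sum_distrib_left[symmetric] mult.assoc mult.left_commute[of _ c])
  show "christoffel_square gW w (Inl a) (Inl b) (Inl c) (Inl d) = christoffel_square gB ?u a b c d"
    "christoffel_square gW w (Inl a) (Inl b) (Inl c) (Inr \<delta>) = 0"
    "christoffel_square gW w (Inl a) (Inl b) (Inr \<gamma>) (Inl d) = 0"
    unfolding split by (simp_all add: christoffel1_gW christoffel_square_def)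
  show "christoffel_square gW w (Inl a) (Inl b) (Inr \<gamma>) (Inr \<delta>) =
    - (gF ?v $ \<gamma> $ \<delta> / 2 * (\<Sum>c\<in>UNIV. christoffel gB ?u c a b * pd c \<psi> ?u))"
  proof -
    have "(\<Sum>m\<in>UNIV. \<Sum>n\<in>UNIV. matrix_inv (gB ?u) $ m $ n * (christoffel1 gB ?u a b m * pd n \<psi> ?u)) =
        (\<Sum>c\<in>UNIV. christoffel gB ?u c a b * pd c \<psi> ?u)"
      unfolding christoffel_eq sum_distrib_right 
      by (subst sum.swap) (simp add: base.inv_sym_nth[OF u, of _ "_ :: 'p"] mult_ac)
    moreover have "(\<Sum>m\<in>UNIV. \<Sum>n\<in>UNIV. matrix_inv (gB ?u) $ m $ n *
        (christoffel1 gB ?u a b m * - (pd n \<psi> ?u / 2 * gF ?v $ \<gamma> $ \<delta>))) =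
      - (gF ?v $ \<gamma> $ \<delta> / 2 * (\<Sum>m\<in>UNIV. \<Sum>n\<in>UNIV. matrix_inv (gB ?u) $ m $ n * (christoffel1 gB ?u a b m * pd n \<psi> ?u)))"
      by (simp add: sum_negf sum_distrib_left mult_ac)
    ultimately show ?thesis
      unfolding split christoffel1_gW by simp
  qed
  show "christoffel_square gW w (Inl a) (Inr \<beta>) (Inl c) (Inr \<delta>) =
      pd a \<psi> ?u * pd c \<psi> ?u / (4 * \<psi> ?u) * gF ?v $ \<beta> $ \<delta>"
    "christoffel_square gW w (Inl a) (Inr \<beta>) (Inr \<gamma>) (Inl d) =
      pd a \<psi> ?u * pd d \<psi> ?u / (4 * \<psi> ?u) * gF ?v $ \<beta> $ \<gamma>"
    "christoffel_square gW w (Inr \<alpha>) (Inl b) (Inr \<gamma>) (Inl d) =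
      pd b \<psi> ?u * pd d \<psi> ?u / (4 * \<psi> ?u) * gF ?v $ \<alpha> $ \<gamma>"
    "christoffel_square gW w (Inr \<alpha>) (Inl b) (Inr \<gamma>) (Inr \<delta>) =
      pd b \<psi> ?u / 2 * christoffel1 gF ?v \<gamma> \<delta> \<alpha>"
    unfolding split christoffel1_gW contract using \<psi> fiber.sym_nth[OF v] by (simp_all add: mult_ac)
  show "christoffel_square gW w (Inr \<alpha>) (Inr \<beta>) (Inr \<gamma>) (Inr \<delta>) =
    \<psi> ?u * christoffel_square gF ?v \<alpha> \<beta> \<gamma> \<delta>
    + (\<psi> ?u)\<^sup>2 * warp_delta ?u * (gF ?v $ \<alpha> $ \<beta> * gF ?v $ \<gamma> $ \<delta>)"
  proof -
    have 1: "(\<psi> ?u)\<^sup>2 * warp_delta ?u = (\<Sum>a\<in>UNIV. \<Sum>b\<in>UNIV. matrix_inv (gB ?u) $ a $ b * pd a \<psi> ?u * pd b \<psi> ?u) / 4"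
      using \<psi> by (simp add: warp_delta_def)
    have 2: "(\<Sum>m\<in>UNIV. \<Sum>n\<in>UNIV. matrix_inv (gF ?v) $ m $ n *
        (\<psi> ?u * christoffel1 gF ?v \<alpha> \<beta> m * (\<psi> ?u * christoffel1 gF ?v \<gamma> \<delta> n))) = (\<psi> ?u)\<^sup>2 * christoffel_square gF ?v \<alpha> \<beta> \<gamma> \<delta>"
      by (simp add: christoffel_square_def sum_distrib_left power2_eq_square mult_ac)
    have 3: "(\<Sum>m\<in>UNIV. \<Sum>n\<in>UNIV. matrix_inv (gB ?u) $ m $ n *
        (- (pd m \<psi> ?u / 2 * gF ?v $ \<alpha> $ \<beta>) * - (pd n \<psi> ?u / 2 * gF ?v $ \<gamma> $ \<delta>))) =
      (\<Sum>a\<in>UNIV. \<Sum>b\<in>UNIV. matrix_inv (gB ?u) $ a $ b * pd a \<psi> ?u * pd b \<psi> ?u) / 4 * (gF ?v $ \<alpha> $ \<beta> * gF ?v $ \<gamma> $ \<delta>)"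
      by (simp add: sum_distrib_left sum_divide_distrib mult_ac)
    show ?thesis
      unfolding split christoffel1_gW 1 2 3 using \<psi> by (simp add: power2_eq_square)
  qed
qed

text \<open>One component for each block type up to the symmetries of the curvature tensor. Those with an odd
number of fiber indices vanish, as do those with the fiber indices in the same pair.\<close>

theorem lowered_curv_gW:
  "lowered_curv gW w (Inl a) (Inl b) (Inl c) (Inl d) = lowered_curv gB (base_part w) a b c d"
  "lowered_curv gW w (Inl a) (Inr \<beta>) (Inl c) (Inr \<delta>) =
    \<psi> (base_part w) * hessT (base_part w) $ a $ c * gF (fiber_part w) $ \<beta> $ \<delta>"
  "lowered_curv gW w (Inr \<alpha>) (Inr \<beta>) (Inr \<gamma>) (Inr \<delta>) =
    \<psi> (base_part w) * (lowered_curv gF (fiber_part w) \<alpha> \<beta> \<gamma> \<delta>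
      - \<psi> (base_part w) * warp_delta (base_part w) * (gF (fiber_part w) $ \<alpha> $ \<delta> * gF (fiber_part w) $ \<beta> $ \<gamma>
        - gF (fiber_part w) $ \<alpha> $ \<gamma> * gF (fiber_part w) $ \<beta> $ \<delta>))"
  "lowered_curv gW w (Inl a) (Inl b) (Inl c) (Inr \<delta>) = 0"
  "lowered_curv gW w (Inl a) (Inl b) (Inr \<gamma>) (Inr \<delta>) = 0"
  "lowered_curv gW w (Inr \<alpha>) (Inr \<beta>) (Inr \<gamma>) (Inl d) = 0"
proof -
  let ?u = "base_part w" and ?v = "fiber_part w"
  have \<psi>: "\<psi> ?u \<noteq> 0" using u by (rule \<psi>_nonzero)
  note sq = lowered_curv_eq christoffel_square_gW pd_pd_gW total.christoffel_square_commute[OF w, of "Inr _" "Inr _" "Inl _" "Inl _"]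
    total.christoffel_square_commute[OF w, of "Inl _" "Inr _" "Inl _" "Inl _"]
  show "lowered_curv gW w (Inl a) (Inl b) (Inl c) (Inl d) = lowered_curv gB ?u a b c d"
    "lowered_curv gW w (Inl a) (Inl b) (Inl c) (Inr \<delta>) = 0"
    by (simp_all add: sq total.christoffel_square_commute[OF w, of "Inl b" "Inr \<delta>"] total.christoffel_square_commute[OF w, of "Inl a" "Inr \<delta>"])
  show "lowered_curv gW w (Inl a) (Inr \<beta>) (Inl c) (Inr \<delta>) = \<psi> ?u * hessT ?u $ a $ c * gF ?v $ \<beta> $ \<delta>"
    using \<psi> twice_differentiable_on_commute[OF base.open_S u twice_\<psi>, of a c] fiber.sym_nth[OF v, of \<beta> \<delta>]
    by (simp add: sq hessT_def total.christoffel_square_commute[OF w, of "Inr _" "Inr _"] field_simps power2_eq_square)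
  show "lowered_curv gW w (Inr \<alpha>) (Inr \<beta>) (Inr \<gamma>) (Inr \<delta>) =
    \<psi> ?u * (lowered_curv gF ?v \<alpha> \<beta> \<gamma> \<delta> - \<psi> ?u * warp_delta ?u * (gF ?v $ \<alpha> $ \<delta> * gF ?v $ \<beta> $ \<gamma> - gF ?v $ \<alpha> $ \<gamma> * gF ?v $ \<beta> $ \<delta>))"
    by (simp add: lowered_curv_eq christoffel_square_gW pd_pd_gW field_simps power2_eq_square)
  show "lowered_curv gW w (Inl a) (Inl b) (Inr \<gamma>) (Inr \<delta>) = 0"
    using fiber.sym_nth[OF v, of \<gamma> \<delta>]
    by (simp add: lowered_curv_eq christoffel_square_gW pd_pd_gW)
  show "lowered_curv gW w (Inr \<alpha>) (Inr \<beta>) (Inr \<gamma>) (Inl d) = 0"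
    using fiber.pd_g_sym[OF v]
    by (simp add: lowered_curv_eq christoffel_square_gW pd_pd_gW christoffel1_def field_simps)
qed

end

end

section \<open>Semisymmetry at a point\<close>

context warped_patch
begin

definition raiseT :: "real^'p \<Rightarrow> real^'p \<Rightarrow> real^'p"
  where "raiseT u x = matrix_inv (gB u) *v (hessT u *v x)"

lemma bil_raiseT:
  assumes "u \<in> U"
  shows "bil (gB u) (raiseT u x) y = bil (hessT u) x y"
proof -
  have "bil (gB u) (raiseT u x) y = bil (gB u) y (raiseT u x)"
    using base.sym_nth[OF assms] by (rule bil_commute)
  also have "\<dots> = bil (hessT u) y x"
    by (simp add: bil_def raiseT_def matrix_vector_mul_assoc matrix_mul_assoc matrix_inv_inverse[OF base.inv[OF assms]])
  also have "\<dots> = bil (hessT u) x y"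
    using transpose_hessT[OF assms] by (intro bil_commute) (simp add: transpose_def vec_eq_iff)
  finally show ?thesis .
qed

lemma bil_hessT_raiseT:
  assumes "u \<in> U"
  shows "bil (hessT u) (raiseT u x) y = bil (hessT u) x (raiseT u y)"
proof -
  interpret g: symmetric_form "bil (gB u)" using base.sym[OF assms] by (rule symmetric_form_bil)
  interpret T: symmetric_form "bil (hessT u)" using transpose_hessT[OF assms] by (rule symmetric_form_bil)
  show ?thesis
    using bil_raiseT[OF assms, of x "raiseT u y"] bil_raiseT[OF assms, of y "raiseT u x"]
      g.commute[of "raiseT u x" "raiseT u y"] T.commute[of "raiseT u x" y] by simp
qed

abbreviation "riemB u X Y Z A \<equiv> bil (gB u) (curv_at gB u X Y Z) A"
abbreviation "riemF v X Y Z A \<equiv> bil (gF v) (curv_at gF v X Y Z) A"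
abbreviation "riemW w X Y Z A \<equiv> bil (gW w) (curv_at gW w X Y Z) A"

text \<open>The curvature tensor of the warped metric and the abstract total curvature are both curvature
tensors, so they agree once their components agree. Nondegeneracy of the metric then identifies the
curvature operators, and the algebraic criterion applies with \<open>\<kappa> = f \<Delta>\<close>.\<close>

theorem semisymmetric_at_iff:
  assumes w: "w \<in> W"
  defines "u \<equiv> base_part w" and "v \<equiv> fiber_part w"
  defines "\<kappa> \<equiv> \<psi> u * warp_delta u"
  shows "(\<forall>X Y X1 X2 X3 X4. derivation4 (curv_at gW w X Y) (riemW w) X1 X2 X3 X4 = 0) \<longleftrightarrow>
    (\<forall>x y x1 x2 x3 x4. derivation4 (curv_at gB u x y) (riemB u) x1 x2 x3 x4 = 0) \<and>
    (\<forall>x y z w. bil (hessT u) y x * bil (hessT u) z w - bil (hessT u) y w * bil (hessT u) z x + riemB u y z w (raiseT u x) = 0) \<and>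
    (\<forall>x y x1 x2 x3 x4. bil (hessT u) x y * (riemF v x1 x2 x3 x4 - \<kappa> * wedge_square (bil (gF v)) x1 x2 x3 x4)
      + \<psi> u * bil (hessT u) x (raiseT u y) * wedge_square (bil (gF v)) x1 x2 x3 x4 = 0) \<and>
    (\<forall>x y x1 x2 x3 x4. derivation4 (curv_at gF v x y) (riemF v) x1 x2 x3 x4
      + \<kappa> * (bil (gF v) x x1 * riemF v y x2 x3 x4 - bil (gF v) y x1 * riemF v x x2 x3 x4
        + (bil (gF v) x x2 * riemF v x1 y x3 x4 - bil (gF v) y x2 * riemF v x1 x x3 x4)
        + (bil (gF v) x x3 * riemF v x1 x2 y x4 - bil (gF v) y x3 * riemF v x1 x2 x x4)
        + (bil (gF v) x x4 * riemF v x1 x2 x3 y - bil (gF v) y x4 * riemF v x1 x2 x3 x)) = 0)"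
proof -
  have u: "u \<in> U" and v: "v \<in> V" using w by (auto simp: product_dom_def u_def v_def)
  interpret opB: curvature_operator "riemB u" "bil (gB u)" "curv_at gB u" by (rule base.curvature_operator[OF u])
  interpret opF: curvature_operator "riemF v" "bil (gF v)" "curv_at gF v" by (rule fiber.curvature_operator[OF v])
  interpret P: curvature_operator "opF.shifted \<kappa>" "bil (gF v)" "opF.shifted_op \<kappa>" by (rule opF.shifted)
  interpret T: symmetric_form "bil (hessT u)" using transpose_hessT[OF u] by (rule symmetric_form_bil)
  interpret wc: warped_curvature "riemB u" "bil (gB u)" "curv_at gB u" "opF.shifted \<kappa>" "bil (gF v)" "opF.shifted_op \<kappa>"
      "bil (hessT u)" "raiseT u" "\<psi> u"
  proof
    show "\<exists>x :: real^'q. x \<noteq> 0" by (rule exI[of _ "axis undefined 1"]) simp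
  qed (use bil_raiseT[OF u] \<psi>_nonzero[OF u] in auto)
  interpret opW: curvature_operator "riemW w" "bil (gW w)" "curv_at gW w" by (rule total.curvature_operator[OF w])
  have low: "riemW w X Y Z A = wc.total_form (parts X) (parts Y) (parts Z) (parts A)" for X Y Z A
  proof (rule curvature_form_eq_on_axes)
    show "curvature_form (riemW w)" ..
    show "curvature_form (\<lambda>X Y Z A. wc.total_form (parts X) (parts Y) (parts Z) (parts A))"
      using wc.curvature_form_total linear_parts by (rule curvature_form_compose)
    fix i j k l :: "'p + 'q"
    let ?L = "lowered_curv gW w" and ?N = "\<lambda>i j k l. wc.total_form (parts (axis i 1)) (parts (axis j 1)) (parts (axis k 1)) (parts (axis l 1))"
    note N = wc.total_form_def parts_def opB.slots opF.slots P.slots T.left T.right opF.h.left opF.h.right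
      opF.shifted_def base.bil_curv_at_axes[OF u] fiber.bil_curv_at_axes[OF v] bil_axes wedge_square_def
    have 1: "?L (Inl a) (Inl b) (Inl c) (Inl d) = ?N (Inl a) (Inl b) (Inl c) (Inl d)"
      "?L (Inl a) (Inr \<beta>) (Inl c) (Inr \<delta>) = ?N (Inl a) (Inr \<beta>) (Inl c) (Inr \<delta>)"
      "?L (Inr \<alpha>) (Inr \<beta>) (Inr \<gamma>) (Inr \<delta>) = ?N (Inr \<alpha>) (Inr \<beta>) (Inr \<gamma>) (Inr \<delta>)"
      "?L (Inl a) (Inl b) (Inl c) (Inr \<delta>) = ?N (Inl a) (Inl b) (Inl c) (Inr \<delta>)"
      "?L (Inl a) (Inl b) (Inr \<gamma>) (Inr \<delta>) = ?N (Inl a) (Inl b) (Inr \<gamma>) (Inr \<delta>)"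
      "?L (Inr \<alpha>) (Inr \<beta>) (Inr \<gamma>) (Inl d) = ?N (Inr \<alpha>) (Inr \<beta>) (Inr \<gamma>) (Inl d)" for a b c d \<alpha> \<beta> \<gamma> \<delta>
      by (simp_all add: lowered_curv_gW[OF w] N u_def[symmetric] v_def[symmetric] \<kappa>_def[symmetric])
    have s34: "?L i j k l = ?N i j k l" if "?L i j l k = ?N i j l k" for i j k l
      using that total.lowered_curv_skew34[OF w, of i j k l] curvature_form.skew34[OF wc.curvature_form_total]
      by metis
    have pair: "?L i j k l = ?N i j k l" if "?L k l i j = ?N k l i j" for i j k l
      using that total.lowered_curv_pair[OF w, of i j k l] curvature_form.pair[OF wc.curvature_form_total]
      by metis
    \<comment> \<open>The remaining ten block types follow from these six by exchanging the last two indices or the two pairs.\<close>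
    have "?L i j k l = ?N i j k l"
      by (cases i; cases j; cases k; cases l; hypsubst; (rule 1 s34[OF 1(2)] s34[OF 1(4)] s34[OF 1(6)] pair[OF 1(5)] pair[OF 1(4)] pair[OF 1(6)]
        pair[OF s34[OF 1(4)]] pair[OF s34[OF 1(6)]] pair[OF s34[OF 1(2)]] s34[OF pair[OF s34[OF 1(2)]]]))
    then show "riemW w (axis i 1) (axis j 1) (axis k 1) (axis l 1) = ?N i j k l"
      by (simp add: total.bil_curv_at_axes[OF w])
  qed
  have op: "parts (curv_at gW w X Y Z) = wc.total_op (parts X) (parts Y) (parts Z)" for X Y Z
  proof -
    obtain a b where ab: "wc.total_op (parts X) (parts Y) (parts Z) = (a, b)" by fastforce
    have "curv_at gW w X Y Z = join a b"
    proof (rule opW.nondegenerate)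
      fix A
      show "riemW w X Y Z A = bil (gW w) (join a b) A"
        unfolding low unfolding bil_warped_metric
        using wc.lower_total_op[of "parts X" "parts Y" "parts Z" "parts A"]
        by (simp add: ab u_def[symmetric] v_def[symmetric]) (simp add: parts_def)
    qed
    then show ?thesis using ab by (simp add: parts_join)
  qed
  have der: "derivation4 (curv_at gW w X Y) (riemW w) X1 X2 X3 X4 =
      derivation4 (wc.total_op (parts X) (parts Y)) wc.total_form (parts X1) (parts X2) (parts X3) (parts X4)" for X Y X1 X2 X3 X4
    by (simp add: derivation4_def low op)
  have "(\<forall>X Y X1 X2 X3 X4. derivation4 (curv_at gW w X Y) (riemW w) X1 X2 X3 X4 = 0) \<longleftrightarrow>
     (\<forall>X Y X1 X2 X3 X4. derivation4 (wc.total_op X Y) wc.total_form X1 X2 X3 X4 = 0)"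
  proof (intro iffI allI)
    fix X Y X1 X2 X3 X4 :: "(real^'p) \<times> (real^'q)"
    let ?j = "\<lambda>X. join (fst X) (snd X)"
    assume "\<forall>X Y X1 X2 X3 X4. derivation4 (curv_at gW w X Y) (riemW w) X1 X2 X3 X4 = 0"
    then have "derivation4 (curv_at gW w (?j X) (?j Y)) (riemW w) (?j X1) (?j X2) (?j X3) (?j X4) = 0" by blast
    then show "derivation4 (wc.total_op X Y) wc.total_form X1 X2 X3 X4 = 0"
      unfolding der parts_join prod.collapse .
  qed (unfold der, blast)
  then show ?thesis
    unfolding wc.semisymmetric_iff opF.derivation4_shifted opF.shifted_def .
qed

lemma linear_raiseT: "linear (raiseT u)"
  by (rule linearI) (simp_all add: raiseT_def matrix_vector_right_distrib matrix_vector_mult_scaleR)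

text \<open>The two tensor conditions that involve \<open>T\<close>, in the form of the algebraic criterion and in components.\<close>

lemma base_condition_components:
  assumes "u \<in> U"
  shows "(\<forall>x y z w. bil (hessT u) y x * bil (hessT u) z w - bil (hessT u) y w * bil (hessT u) z x + riemB u y z w (raiseT u x) = 0)
    \<longleftrightarrow> (\<forall>a b c s. hessT u $ a $ s * hessT u $ b $ c - hessT u $ a $ c * hessT u $ b $ s
         + (\<Sum>t\<in>UNIV. raiseT u (axis s 1) $ t * riemB u (axis a 1) (axis b 1) (axis c 1) (axis t 1)) = 0)" (is "?V \<longleftrightarrow> ?C")
proof -
  interpret op: curvature_operator "riemB u" "bil (gB u)" "curv_at gB u" using assms by (rule base.curvature_operator)
  interpret T: symmetric_form "bil (hessT u)" using transpose_hessT[OF assms] by (rule symmetric_form_bil)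
  interpret r: linear "raiseT u" by (rule linear_raiseT)
  let ?H = "\<lambda>x y z w. bil (hessT u) y x * bil (hessT u) z w - bil (hessT u) y w * bil (hessT u) z x + riemB u y z w (raiseT u x)"
  have "?V \<longleftrightarrow> (\<forall>a b c s. ?H (axis s 1) (axis a 1) (axis b 1) (axis c 1) = 0)"
  proof (intro iffI allI)
    fix x y z w assume *: "\<forall>a b c s. ?H (axis s 1) (axis a 1) (axis b 1) (axis c 1) = 0"
    show "?H x y z w = 0"
    proof (rule linear4_eq_0_on_axes[of ?H])
      show "?H (axis i 1) (axis j 1) (axis k 1) (axis l 1) = 0" for i j k l using * by blast
    qed (rule linearI; simp add: op.slots T.left T.right r.add r.scale algebra_simps)+
  qed blast
  moreover have "riemB u x y z (raiseT u w) = (\<Sum>t\<in>UNIV. raiseT u w $ t * riemB u x y z (axis t 1))" for x y z w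
  proof -
    define X where "X = raiseT u w"
    interpret l: linear "riemB u x y z" by (rule linear_bil_right)
    have "riemB u x y z X = riemB u x y z (\<Sum>t\<in>UNIV. X $ t *\<^sub>R axis t 1)"
      using basis_expansion[of X] by (simp add: scalar_mult_eq_scaleR)
    then show ?thesis unfolding X_def[symmetric] by (simp only: l.sum l.scale) simp
  qed
  ultimately show ?thesis by (simp add: bil_axes)
qed

lemma mixed_condition_components:
  assumes "u \<in> U" "v \<in> V"
  shows "(\<forall>x y x1 x2 x3 x4. bil (hessT u) x y * (riemF v x1 x2 x3 x4 - \<kappa> * wedge_square (bil (gF v)) x1 x2 x3 x4)
      + \<phi> * bil (hessT u) x (raiseT u y) * wedge_square (bil (gF v)) x1 x2 x3 x4 = 0) \<longleftrightarrow>
    (\<forall>a s \<eta> \<alpha> \<beta> \<gamma>. hessT u $ a $ s * (riemF v (axis \<eta> 1) (axis \<alpha> 1) (axis \<beta> 1) (axis \<gamma> 1)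
        - \<kappa> * wedge_square (bil (gF v)) (axis \<eta> 1) (axis \<alpha> 1) (axis \<beta> 1) (axis \<gamma> 1))
      + \<phi> * bil (hessT u) (axis a 1) (raiseT u (axis s 1)) * wedge_square (bil (gF v)) (axis \<eta> 1) (axis \<alpha> 1) (axis \<beta> 1) (axis \<gamma> 1) = 0)"
    (is "?V \<longleftrightarrow> ?C")
proof (intro iffI allI)
  interpret op: curvature_operator "riemF v" "bil (gF v)" "curv_at gF v" using assms(2) by (rule fiber.curvature_operator)
  interpret T: symmetric_form "bil (hessT u)" using transpose_hessT[OF assms(1)] by (rule symmetric_form_bil)
  interpret r: linear "raiseT u" by (rule linear_raiseT)
  let ?H = "\<lambda>x y x1 x2 x3 x4. bil (hessT u) x y * (riemF v x1 x2 x3 x4 - \<kappa> * wedge_square (bil (gF v)) x1 x2 x3 x4)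
      + \<phi> * bil (hessT u) x (raiseT u y) * wedge_square (bil (gF v)) x1 x2 x3 x4"
  fix x y x1 x2 x3 x4 assume C: ?C
  show "?H x y x1 x2 x3 x4 = 0"
  proof (rule linear4_eq_0_on_axes[of "?H x y"])
    fix i j k l
    show "?H x y (axis i 1) (axis j 1) (axis k 1) (axis l 1) = 0"
    proof (rule linear2_eq_0_on_axes[of "\<lambda>x y. ?H x y (axis i 1) (axis j 1) (axis k 1) (axis l 1)"])
      fix a s
      show "?H (axis a 1) (axis s 1) (axis i 1) (axis j 1) (axis k 1) (axis l 1) = 0"
        unfolding bil_axes[of "hessT u" a s] using C by blast
    qed (rule linearI; simp add: T.left T.right r.add r.scale algebra_simps)+
  qed (rule linearI; simp add: wedge_square_def op.slots op.h.left op.h.right algebra_simps)+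
next
  fix a s \<eta> \<alpha> \<beta> \<gamma> assume V: ?V
  show "hessT u $ a $ s * (riemF v (axis \<eta> 1) (axis \<alpha> 1) (axis \<beta> 1) (axis \<gamma> 1)
        - \<kappa> * wedge_square (bil (gF v)) (axis \<eta> 1) (axis \<alpha> 1) (axis \<beta> 1) (axis \<gamma> 1))
      + \<phi> * bil (hessT u) (axis a 1) (raiseT u (axis s 1)) * wedge_square (bil (gF v)) (axis \<eta> 1) (axis \<alpha> 1) (axis \<beta> 1) (axis \<gamma> 1) = 0"
    using V[THEN spec, of "axis a 1", THEN spec, of "axis s 1"] by (simp add: bil_axes)
qed

end

section \<open>Semisymmetric warped products\<close>

lemma curv_op_eq: "curv_op M i x = curv_at (gmat M i) (coord M i x)"
  by (simp add: curv_op_def fun_eq_iff)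

lemma riem_eq: "riem M i x = (\<lambda>X Y Z A. bil (gmat M i (coord M i x)) (curv_at (gmat M i) (coord M i x) X Y Z) A)"
  by (simp add: riem_def metric_tensor_def curv_op_eq fun_eq_iff)

lemma metric_tensor_eq: "metric_tensor M i x = bil (gmat M i (coord M i x))"
  by (simp add: metric_tensor_def fun_eq_iff)

lemma G_tensor_eq: "G_tensor M i x = wedge_square (metric_tensor M i x)"
  by (simp add: G_tensor_def wedge_square_def fun_eq_iff)

lemma R_dot_R_eq_derivation4:
  "R_dot_R M i x [X1, X2, X3, X4] X Y = - derivation4 (curv_op M i x X Y) (riem M i x) X1 X2 X3 X4"
  by (simp add: R_dot_R_def curv_dot_def riem4_def derivation4_def lessThan_Suc eval_nat_numeral)

text \<open>The bracketing matches the Tachibana term of \<open>derivation4_shifted\<close>.\<close>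

lemma Q_g_R_eq:
  "Q_g_R M i x [X1, X2, X3, X4] X Y = (let g = metric_tensor M i x; R = riem M i x in
    g X X1 * R Y X2 X3 X4 - g Y X1 * R X X2 X3 X4 + (g X X2 * R X1 Y X3 X4 - g Y X2 * R X1 X X3 X4)
      + (g X X3 * R X1 X2 Y X4 - g Y X3 * R X1 X2 X X4) + (g X X4 * R X1 X2 X3 Y - g Y X4 * R X1 X2 X3 X))"
  by (simp add: Q_g_R_def tachibana_Q_def riem4_def lessThan_Suc eval_nat_numeral Let_def)

lemma all_lists_length_4:
  "(\<forall>Xs X Y. length Xs = 4 \<longrightarrow> \<Phi> Xs X Y) \<longleftrightarrow> (\<forall>X Y a b c d. \<Phi> [a, b, c, d] X Y)"
  by (auto simp: eval_nat_numeral length_Suc_conv)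

lemma semi_riemannian_manifold_metric_patch:
  assumes "semi_riemannian_manifold M" "i \<in> charts M"
  shows "metric_patch (coord M i ` chart_dom M i) (gmat M i)"
  using assms unfolding semi_riemannian_manifold_def smooth_manifold_def
  by (intro metric_patch.intro smooth_on_imp_twice_differentiable_on) auto

lemma chart_inv_coord:
  assumes "smooth_manifold M" "i \<in> charts M" "x \<in> chart_dom M i"
  shows "chart_inv M i (coord M i x) = x"
proof -
  have "openin (mtop M) (chart_dom M i)"
    and "homeomorphic_map (subtopology (mtop M) (chart_dom M i)) (top_of_set (coord M i ` chart_dom M i)) (coord M i)"
    using assms unfolding smooth_manifold_def by auto
  then have "inj_on (coord M i) (chart_dom M i)"
    by (metis homeomorphic_imp_injective_map topspace_subtopology_subset openin_subset)
  then show ?thesis using assms(3) by simp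
qed

theorem corollary5p2:
  fixes B :: "('a, 'i, 'p::finite) semi_riemannian"
    and F :: "('b, 'j, 'q::finite) semi_riemannian"
    and f :: "'a \<Rightarrow> real"
  assumes "semi_riemannian_manifold B"
    and "semi_riemannian_manifold F"
    and "CARD('p) + CARD('q) \<ge> 3"
    and "smooth_fun B f"
    and "\<forall>x\<in>topspace (mtop B). f x > 0"
    and "connected_space (mtop (warped_product B f F))"
  shows "semisymmetric (warped_product B f F) \<longleftrightarrow>
    (\<forall>i\<in>charts B. \<forall>j\<in>charts F. \<forall>x\<in>chart_dom B i. \<forall>y\<in>chart_dom F j.
      (\<forall>Xs X Y. length Xs = 4 \<longrightarrow> R_dot_R B i x Xs X Y = 0) \<and>
      (\<forall>a b c s. warp_T B f i x a s * warp_T B f i x b c - warp_T B f i x a c * warp_T B f i x b s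
         + (\<Sum>t\<in>UNIV. warp_T_up B f i x t s * riem_comp B i x a b c t) = 0) \<and>
      (\<forall>a s \<eta> \<alpha> \<beta> \<gamma>.
         warp_T B f i x a s *
           (riem_comp F j y \<eta> \<alpha> \<beta> \<gamma> - f x * warp_Delta B f i x * G_comp F j y \<eta> \<alpha> \<beta> \<gamma>)
         + f x * warp_T2 B f i x a s * G_comp F j y \<eta> \<alpha> \<beta> \<gamma> = 0) \<and>
      (\<forall>Xs X Y. length Xs = 4 \<longrightarrow>
         R_dot_R F j y Xs X Y = f x * warp_Delta B f i x * Q_g_R F j y Xs X Y))"
    (is "_ \<longleftrightarrow> (\<forall>i\<in>_. \<forall>j\<in>_. \<forall>x\<in>_. \<forall>y\<in>_. ?conds i j x y)")
proof -
  have smB: "smooth_manifold B" using assms(1) by (simp add: semi_riemannian_manifold_def)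
  let ?M = "warped_product B f F"
  have pointwise: "semisymmetric ?M \<longleftrightarrow> (\<forall>i\<in>charts B. \<forall>j\<in>charts F. \<forall>x\<in>chart_dom B i. \<forall>y\<in>chart_dom F j.
      \<forall>Xs X Y. length Xs = 4 \<longrightarrow> R_dot_R ?M (i, j) (x, y) Xs X Y = 0)"
    unfolding semisymmetric_def by (force simp: warped_product_def)
  have at_point: "(\<forall>Xs X Y. length Xs = 4 \<longrightarrow> R_dot_R ?M (i, j) (x, y) Xs X Y = 0) \<longleftrightarrow> ?conds i j x y"
    if i: "i \<in> charts B" and j: "j \<in> charts F" and x: "x \<in> chart_dom B i" and y: "y \<in> chart_dom F j" for i j x y
  proof -
    define u where "u = coord B i x"
    define v where "v = coord F j y"
    let ?\<psi> = "local_rep B i f"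
    have dom: "z \<in> topspace (mtop B)" if "z \<in> chart_dom B i" for z
      using smB i that unfolding smooth_manifold_def by blast
    interpret wp: warped_patch "coord B i ` chart_dom B i" "gmat B i" "coord F j ` chart_dom F j" "gmat F j" ?\<psi>
    proof (intro warped_patch.intro warped_patch_axioms.intro)
      show "metric_patch (coord B i ` chart_dom B i) (gmat B i)"
        using assms(1) i by (rule semi_riemannian_manifold_metric_patch)
      show "metric_patch (coord F j ` chart_dom F j) (gmat F j)"
        using assms(2) j by (rule semi_riemannian_manifold_metric_patch)
      show "twice_differentiable_on (coord B i ` chart_dom B i) ?\<psi>"
        using assms(4) i by (auto simp: smooth_fun_def intro: smooth_on_imp_twice_differentiable_on)
      show "?\<psi> u' \<noteq> 0" if "u' \<in> coord B i ` chart_dom B i" for u'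
      proof -
        obtain z where z: "z \<in> chart_dom B i" "u' = coord B i z" using \<open>u' \<in> _\<close> by blast
        then have "?\<psi> u' = f z" using chart_inv_coord[OF smB i] by (simp add: local_rep_def)
        then show ?thesis using assms(5) dom[OF z(1)] by auto
      qed
    qed
    have u: "u \<in> coord B i ` chart_dom B i" and v: "v \<in> coord F j ` chart_dom F j"
      using x y by (auto simp: u_def v_def)
    have \<psi>u: "?\<psi> u = f x"
      using chart_inv_coord[OF smB i x] by (simp add: local_rep_def u_def)
    have w: "join u v \<in> product_dom (coord B i ` chart_dom B i) (coord F j ` chart_dom F j)"
      using u v by (simp add: product_dom_def)
    have gM: "gmat ?M (i, j) = wp.gW" and cM: "coord ?M (i, j) (x, y) = join u v"
      by (simp_all add: warped_product_def warped_metric_def fun_eq_iff u_def v_def)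
    have T: "warp_T B f i x a b = wp.hessT u $ a $ b" for a b
      unfolding warp_T_def wp.hessT_def cov_hess_def d1_def \<psi>u u_def[symmetric] by simp
    have Delta: "warp_Delta B f i x = wp.warp_delta u"
      unfolding warp_Delta_def wp.warp_delta_def ginv_def d1_def \<psi>u u_def[symmetric] by simp
    have Tup: "warp_T_up B f i x t s = wp.raiseT u (axis s 1) $ t" for t s
      by (simp add: warp_T_up_def wp.raiseT_def ginv_def T u_def[symmetric] matrix_vector_mult_basis)
        (simp add: matrix_vector_mult_def column_def)
    have T2: "warp_T2 B f i x a s = bil (wp.hessT u) (axis a 1) (wp.raiseT u (axis s 1))" for a s
      unfolding wp.bil_hessT_raiseT[OF u, symmetric] by (simp add: warp_T2_def Tup T bil_axis_right)
    have riemB: "riem B i x = wp.riemB u" and riemF: "riem F j y = wp.riemF v"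
      by (simp_all add: riem_eq u_def v_def)
    have "(\<forall>Xs X Y. length Xs = 4 \<longrightarrow> R_dot_R ?M (i, j) (x, y) Xs X Y = 0) \<longleftrightarrow>
        (\<forall>X Y X1 X2 X3 X4. derivation4 (curv_at wp.gW (join u v) X Y) (wp.riemW (join u v)) X1 X2 X3 X4 = 0)"
      unfolding all_lists_length_4 R_dot_R_eq_derivation4 curv_op_eq riem_eq gM cM by auto
    moreover have "(\<forall>Xs X Y. length Xs = 4 \<longrightarrow> R_dot_R B i x Xs X Y = 0) \<longleftrightarrow>
        (\<forall>x y x1 x2 x3 x4. derivation4 (curv_at (gmat B i) u x y) (wp.riemB u) x1 x2 x3 x4 = 0)"
      unfolding all_lists_length_4 R_dot_R_eq_derivation4 curv_op_eq riemB u_def[symmetric] by auto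
    moreover have "(\<forall>Xs X Y. length Xs = 4 \<longrightarrow>
         R_dot_R F j y Xs X Y = f x * warp_Delta B f i x * Q_g_R F j y Xs X Y) \<longleftrightarrow>
       (\<forall>X Y X1 X2 X3 X4. derivation4 (curv_at (gmat F j) v X Y) (wp.riemF v) X1 X2 X3 X4
        + (f x * warp_Delta B f i x) * (bil (gmat F j v) X X1 * wp.riemF v Y X2 X3 X4 - bil (gmat F j v) Y X1 * wp.riemF v X X2 X3 X4
        + (bil (gmat F j v) X X2 * wp.riemF v X1 Y X3 X4 - bil (gmat F j v) Y X2 * wp.riemF v X1 X X3 X4)
        + (bil (gmat F j v) X X3 * wp.riemF v X1 X2 Y X4 - bil (gmat F j v) Y X3 * wp.riemF v X1 X2 X X4)
        + (bil (gmat F j v) X X4 * wp.riemF v X1 X2 X3 Y - bil (gmat F j v) Y X4 * wp.riemF v X1 X2 X3 X)) = 0)"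
      unfolding all_lists_length_4 R_dot_R_eq_derivation4 Q_g_R_eq Let_def curv_op_eq riemF metric_tensor_eq v_def[symmetric]
      unfolding neg_eq_iff_add_eq_0 ..
    moreover have "(\<forall>a b c s. warp_T B f i x a s * warp_T B f i x b c - warp_T B f i x a c * warp_T B f i x b s
         + (\<Sum>t\<in>UNIV. warp_T_up B f i x t s * riem_comp B i x a b c t) = 0) \<longleftrightarrow>
       (\<forall>x y z w. bil (wp.hessT u) y x * bil (wp.hessT u) z w - bil (wp.hessT u) y w * bil (wp.hessT u) z x + wp.riemB u y z w (wp.raiseT u x) = 0)"
      unfolding wp.base_condition_components[OF u] T Tup riem_comp_def riemB ..
    moreover have "(\<forall>a s \<eta> \<alpha> \<beta> \<gamma>.
         warp_T B f i x a s *
           (riem_comp F j y \<eta> \<alpha> \<beta> \<gamma> - f x * warp_Delta B f i x * G_comp F j y \<eta> \<alpha> \<beta> \<gamma>)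
         + f x * warp_T2 B f i x a s * G_comp F j y \<eta> \<alpha> \<beta> \<gamma> = 0) \<longleftrightarrow>
       (\<forall>X Y x1 x2 x3 x4. bil (wp.hessT u) X Y * (wp.riemF v x1 x2 x3 x4 - (f x * warp_Delta B f i x) * wedge_square (bil (gmat F j v)) x1 x2 x3 x4)
      + f x * bil (wp.hessT u) X (wp.raiseT u Y) * wedge_square (bil (gmat F j v)) x1 x2 x3 x4 = 0)"
      unfolding wp.mixed_condition_components[OF u v] T T2 riem_comp_def riemF G_comp_def G_tensor_eq metric_tensor_eq v_def[symmetric] ..
    ultimately show ?thesis
      using wp.semisymmetric_at_iff[OF w] by (simp only: base_part_join fiber_part_join \<psi>u Delta)
  qed
  show ?thesis unfolding pointwise by (intro ball_cong refl at_point)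
qed

end
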